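(* Let $(X,\omega)$ be a complex Hermitian manifold with $\dim_{\mathbb C}X=n\ge2$. Fix any $C^\infty$ function $\eta$ on $X$ such that $\eta>0$ or $\eta<0$. (i) For any bidegree $(p,q)$ and any $C^\infty$ $(p,q)$-form $u$ on $X$, $$i\,[D^{0,1}_\eta,\overline{D^{0,1}_\eta}]\,u=-\frac1\eta\Big(i\bar\partial\eta\wedge\partial u+i\partial\eta\wedge\bar\partial u\Big)+\frac{p-q}\eta\Big(\frac2\eta\,i\partial\eta\wedge\bar\partial\eta-i\partial\bar\partial\eta\Big)\wedge u$$ and $$\begin{aligned}i\,\Big[[D^{0,1}_\eta,\overline{D^{0,1}_\eta}],\Lambda\Big]u&=\frac1\eta\,[\Lambda,i\bar\partial\eta\wedge\cdot\,]\,\partial u+\frac1\eta\,[\Lambda,i\partial\eta\wedge\cdot\,]\,\bar\partial u+\frac1\eta\,i\bar\partial\eta\wedge[\Lambda,\partial]\,u+\frac1\eta\,i\partial\eta\wedge[\Lambda,\bar\partial]\,u\\&\quad+(p-q)\,\Big[\Big(\frac2{\eta^2}\,i\partial\eta\wedge\bar\partial\eta-\frac1\eta\,i\partial\bar\partial\eta\Big)\wedge\cdot\,,\ \Lambda\Big]\,u.\end{aligned}$$ (ii) The following identities hold: $$D^{0,1}_\eta\overline{D^{0,1}_\eta}\omega=\eta^2\,\bar\partial\Big(\frac1\eta\,\partial\Big(\frac1\eta\,\omega\Big)\Big)=-\partial\bar\partial\omega-\frac1\eta\Big(2\,\bar\partial\eta\wedge\partial\omega-\partial\eta\wedge\ba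r\partial\omega\Big)+\frac1\eta\Big(\partial\bar\partial\eta-\frac3\eta\,\partial\eta\wedge\bar\partial\eta\Big)\wedge\omega.$$
   Context: $\eta$ is real-valued and $\eta>0$ (resp. $\eta<0$) means at every point. The Hermitian metric is identified with its positive definite $(1,1)$-form $\omega$. $\Lambda$ is the pointwise adjoint of $\omega\wedge\cdot$ for the inner product induced by $\omega$; $[A,B]=AB-(-1)^{ab}BA$ is the graded commutator of operators of degrees $a,b$. On $(p,q)$-forms, $D^{0,1}_\eta=\bar\partial-\frac p\eta\,\bar\partial\eta\wedge\cdot$, and its conjugate, defined by $\overline{D^{0,1}_\eta}u=\overline{D^{0,1}_\eta\bar u}$, is $\overline{D^{0,1}_\eta}=\partial-\frac q\eta\,\partial\eta\wedge\cdot$. *)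

theory Defs
  imports "HOL-Analysis.Analysis" "HOL-Library.Function_Algebras"
begin

section \<open>The exterior algebra of a complex coordinate space\<close>

text \<open>
  An element of \<open>'n ext\<close> is a complex exterior form (of mixed degree) at one point of
  \<open>\<complex>\<^sup>n\<close>, with \<open>n = CARD('n)\<close>: its \<open>(I, J)\<close> entry is the coefficient of
  \<open>dz\<^sub>I \<and> dzbar\<^sub>J\<close>, the factors in each of \<open>dz\<^sub>I\<close>, \<open>dzbar\<^sub>J\<close> being in increasing order of
  their index. The linear order on \<open>'n\<close> serves only to name this basis.
\<close>

type_synonym 'n ext = "complex ^ ('n set \<times> 'n set)"

type_synonym 'n cmat = "complex ^ 'n ^ 'n"

definition dz :: "'n::{finite,linorder} \<Rightarrow> 'n ext"
  where "dz j = axis ({j}, {}) 1"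

definition dzbar :: "'n::{finite,linorder} \<Rightarrow> 'n ext"
  where "dzbar j = axis ({}, {j}) 1"

definition inversions :: "'n::{finite,linorder} set \<Rightarrow> 'n set \<Rightarrow> nat"
  where "inversions I K = card {(i, k). i \<in> I \<and> k \<in> K \<and> k < i}"

text \<open>
  The sign is that of reordering \<open>dz\<^sub>I \<and> dzbar\<^sub>J \<and> dz\<^sub>K \<and> dzbar\<^sub>L\<close> into
  \<open>dz\<^bsub>I\<union>K\<^esub> \<and> dzbar\<^bsub>J\<union>L\<^esub>\<close>, with \<open>K = M - I\<close> and \<open>L = N - J\<close>.
\<close>
definition ext_wedge :: "'n::{finite,linorder} ext \<Rightarrow> 'n ext \<Rightarrow> 'n ext"
  where "ext_wedge a b = (\<chi> s. case s of (M, N) \<Rightarrow>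
    (\<Sum>I\<in>Pow M. \<Sum>J\<in>Pow N.
      (- 1) ^ (card J * card (M - I) + inversions I (M - I) + inversions J (N - J))
        * a $ (I, J) * b $ (M - I, N - J)))"

definition ext_cnj :: "'n::{finite,linorder} ext \<Rightarrow> 'n ext"
  where "ext_cnj a = (\<chi> s. case s of (I, J) \<Rightarrow> (- 1) ^ (card I * card J) * cnj (a $ (J, I)))"

text \<open>
  The determinant of the submatrix with rows \<open>I\<close> and columns \<open>K\<close> (Leibniz formula); it is \<open>0\<close>
  if \<open>card I \<noteq> card K\<close>, since there is then no bijection.
\<close>
definition minor :: "'n cmat \<Rightarrow> 'n::{finite,linorder} set \<Rightarrow> 'n set \<Rightarrow> complex"
  where "minor M I K = (\<Sum>f | f \<in> extensional I \<and> bij_betw f I K.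
    (- 1) ^ card {(i, j). i \<in> I \<and> j \<in> I \<and> i < j \<and> f j < f i} * (\<Prod>i\<in>I. M $ i $ f i))"

text \<open>Pullback under a complex linear map: \<open>dz\<^sub>j \<mapsto> \<Sum>\<^sub>k M\<^sub>j\<^sub>k dz\<^sub>k\<close>, \<open>dzbar\<^sub>j \<mapsto> \<Sum>\<^sub>k cnj M\<^sub>j\<^sub>k dzbar\<^sub>k\<close>.\<close>
definition ext_pullback :: "'n cmat \<Rightarrow> 'n::{finite,linorder} ext \<Rightarrow> 'n ext"
  where "ext_pullback M a = (\<chi> s. case s of (K, L) \<Rightarrow>
    (\<Sum>I\<in>UNIV. \<Sum>J\<in>UNIV. a $ (I, J) * minor M I K * cnj (minor M J L)))"


section \<open>The inner product induced by a positive (1,1)-form, and the adjoint\<close>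

text \<open>The matrix \<open>h\<close> in \<open>w = i \<Sum> h\<^sub>j\<^sub>k dz\<^sub>j \<and> dzbar\<^sub>k\<close>.\<close>
definition herm_matrix :: "'n::{finite,linorder} ext \<Rightarrow> 'n cmat"
  where "herm_matrix w = (\<chi> j k. - \<i> * w $ ({j}, {k}))"

definition pos_def_11 :: "'n::{finite,linorder} ext \<Rightarrow> bool"
  where "pos_def_11 w \<longleftrightarrow>
    (\<forall>I J. w $ (I, J) \<noteq> 0 \<longrightarrow> card I = 1 \<and> card J = 1) \<and>
    ext_cnj w = w \<and>
    (\<forall>v. v \<noteq> 0 \<longrightarrow>
      (let s = (\<Sum>j\<in>UNIV. \<Sum>k\<in>UNIV. herm_matrix w $ j $ k * v $ j * cnj (v $ k))
       in s \<in> \<real> \<and> 0 < Re s))"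

text \<open>
  The Gram matrix \<open>\<langle>dz\<^sub>j, dz\<^sub>k\<rangle>\<close> of the dual metric. If \<open>w = i \<Sum>\<^sub>a e\<^sub>a \<and> cnj e\<^sub>a\<close> for a coframe \<open>e\<close>, then
  \<open>e\<close> is orthonormal for it.
\<close>
definition dual_gram :: "'n::{finite,linorder} ext \<Rightarrow> 'n cmat"
  where "dual_gram w = transpose (matrix_inv (herm_matrix w))"

text \<open>
  \<open>\<langle>dz\<^sub>I \<and> dzbar\<^sub>J, dz\<^sub>K \<and> dzbar\<^sub>L\<rangle> = det (\<langle>dz\<^sub>i, dz\<^sub>k\<rangle>) det (\<langle>dzbar\<^sub>j, dzbar\<^sub>l\<rangle>)\<close>, extended
  sesquilinearly. For an orthonormal coframe \<open>e\<close> as above, the forms \<open>e\<^sub>I \<and> cnj e\<^sub>J\<close> are orthonormal.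
\<close>
definition ext_inner :: "'n::{finite,linorder} ext \<Rightarrow> 'n ext \<Rightarrow> 'n ext \<Rightarrow> complex"
  where "ext_inner w a b =
    (\<Sum>I\<in>UNIV. \<Sum>J\<in>UNIV. \<Sum>K\<in>UNIV. \<Sum>L\<in>UNIV.
      a $ (I, J) * cnj (b $ (K, L)) * minor (dual_gram w) I K * cnj (minor (dual_gram w) J L))"

definition ext_Lambda :: "'n::{finite,linorder} ext \<Rightarrow> 'n ext \<Rightarrow> 'n ext"
  where "ext_Lambda w a = (THE b. \<forall>v. ext_inner w b v = ext_inner w a (ext_wedge w v))"


section \<open>Smooth and holomorphic maps on open sets\<close>

primrec Ck_on :: "nat \<Rightarrow> 'a::real_normed_vector set \<Rightarrow> ('a \<Rightarrow> 'b::real_normed_vector) \<Rightarrow> bool"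
  where
    "Ck_on 0 S f \<longleftrightarrow> continuous_on S f"
  | "Ck_on (Suc k) S f \<longleftrightarrow>
      (\<forall>x\<in>S. f differentiable (at x)) \<and> (\<forall>v. Ck_on k S (\<lambda>x. frechet_derivative f (at x) v))"

definition smooth_on :: "'a::real_normed_vector set \<Rightarrow> ('a \<Rightarrow> 'b::real_normed_vector) \<Rightarrow> bool"
  where "smooth_on S f \<longleftrightarrow> (\<forall>k. Ck_on k S f)"

definition holo_map_on :: "(complex ^ 'n) set \<Rightarrow> (complex ^ 'n \<Rightarrow> complex ^ 'm) \<Rightarrow> bool"
  where "holo_map_on S f \<longleftrightarrow>
    (\<forall>z\<in>S. \<exists>f'. (f has_derivative f') (at z) \<and> (\<forall>a v. f' (a *s v) = a *s f' v))"

text \<open>The Wirtinger derivatives with respect to \<open>z\<^sub>j\<close> and its conjugate.\<close>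

definition wirt :: "'n \<Rightarrow> (complex ^ 'n \<Rightarrow> complex ^ 'm) \<Rightarrow> complex ^ 'n \<Rightarrow> complex ^ 'm"
  where "wirt j f z = (1/2) *s
    (frechet_derivative f (at z) (axis j 1) - \<i> *s frechet_derivative f (at z) (axis j \<i>))"

definition wirtbar :: "'n \<Rightarrow> (complex ^ 'n \<Rightarrow> complex ^ 'm) \<Rightarrow> complex ^ 'n \<Rightarrow> complex ^ 'm"
  where "wirtbar j f z = (1/2) *s
    (frechet_derivative f (at z) (axis j 1) + \<i> *s frechet_derivative f (at z) (axis j \<i>))"


section \<open>Complex manifolds\<close>

type_synonym ('a, 'n) chart = "'a set \<times> ('a \<Rightarrow> complex ^ 'n)"

abbreviation dom_of :: "('a, 'n::finite) chart \<Rightarrow> 'a set"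
  where "dom_of c \<equiv> fst c"

abbreviation coord :: "('a, 'n::finite) chart \<Rightarrow> 'a \<Rightarrow> complex ^ 'n"
  where "coord c \<equiv> snd c"

abbreviation img_of :: "('a, 'n::finite) chart \<Rightarrow> (complex ^ 'n) set"
  where "img_of c \<equiv> coord c ` dom_of c"

abbreviation param :: "('a, 'n::finite) chart \<Rightarrow> complex ^ 'n \<Rightarrow> 'a"
  where "param c \<equiv> inv_into (dom_of c) (coord c)"

definition is_chart :: "'a topology \<Rightarrow> ('a, 'n::finite) chart \<Rightarrow> bool"
  where "is_chart X c \<longleftrightarrow> openin X (dom_of c) \<and> open (img_of c) \<and>
    homeomorphic_map (subtopology X (dom_of c)) (top_of_set (img_of c)) (coord c)"

definition transition :: "('a, 'n::finite) chart \<Rightarrow> ('a, 'n) chart \<Rightarrow> complex ^ 'n \<Rightarrow> complex ^ 'n"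
  where "transition c d = coord d \<circ> param c"

definition complex_manifold :: "'a topology \<Rightarrow> ('a, 'n::finite) chart set \<Rightarrow> bool"
  where "complex_manifold X A \<longleftrightarrow> Hausdorff_space X \<and> second_countable X \<and>
    (\<forall>c\<in>A. is_chart X c) \<and> (\<Union>c\<in>A. dom_of c) = topspace X \<and>
    (\<forall>c\<in>A. \<forall>d\<in>A. holo_map_on (coord c ` (dom_of c \<inter> dom_of d)) (transition c d))"

definition smooth_function :: "('a, 'n::finite) chart set \<Rightarrow> ('a \<Rightarrow> real) \<Rightarrow> bool"
  where "smooth_function A f \<longleftrightarrow> (\<forall>c\<in>A. smooth_on (img_of c) (f \<circ> param c))"


section \<open>Differential forms\<close>

text \<open>
  A form is the family of its coordinate expressions: \<open>u c x\<close> lists the coefficients of \<open>u\<close> at \<open>x\<close>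
  in the chart \<open>c\<close>. Only the values for \<open>c\<close> in the atlas and \<open>x\<close> in the domain of \<open>c\<close> matter, so
  equality of forms on the manifold is \<open>same_form\<close> rather than \<open>=\<close>. Sums of forms are
  pointwise. The derivatives, wedge products and adjoints below are computed chart by chart.
\<close>
type_synonym ('a, 'n) form = "('a, 'n) chart \<Rightarrow> 'a \<Rightarrow> 'n ext"

definition same_form ::
    "('a, 'n) chart set \<Rightarrow> ('a, 'n::{finite,linorder}) form \<Rightarrow> ('a, 'n) form \<Rightarrow> bool"
  where "same_form A u v \<longleftrightarrow> (\<forall>c\<in>A. \<forall>x\<in>dom_of c. u c x = v c x)"

definition jacobian ::
    "('a, 'n::finite) chart \<Rightarrow> ('a, 'n) chart \<Rightarrow> 'a \<Rightarrow> 'n cmat"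
  where "jacobian c d x = (\<chi> i k. wirt k (transition c d) (coord c x) $ i)"

definition smooth_form :: "('a, 'n) chart set \<Rightarrow> ('a, 'n::{finite,linorder}) form \<Rightarrow> bool"
  where "smooth_form A u \<longleftrightarrow>
    (\<forall>c\<in>A. smooth_on (img_of c) (u c \<circ> param c)) \<and>
    (\<forall>c\<in>A. \<forall>d\<in>A. \<forall>x\<in>dom_of c \<inter> dom_of d. u c x = ext_pullback (jacobian c d x) (u d x))"

definition has_bidegree ::
    "('a, 'n) chart set \<Rightarrow> nat \<Rightarrow> nat \<Rightarrow> ('a, 'n::{finite,linorder}) form \<Rightarrow> bool"
  where "has_bidegree A p q u \<longleftrightarrow> (\<forall>c\<in>A. \<forall>x\<in>dom_of c. \<forall>I J.
    u c x $ (I, J) \<noteq> 0 \<longrightarrow> card I = p \<and> card J = q)"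

definition hermitian_manifold ::
    "'a topology \<Rightarrow> ('a, 'n) chart set \<Rightarrow> ('a, 'n::{finite,linorder}) form \<Rightarrow> bool"
  where "hermitian_manifold X A \<omega> \<longleftrightarrow> complex_manifold X A \<and>
    smooth_form A \<omega> \<and> (\<forall>c\<in>A. \<forall>x\<in>dom_of c. pos_def_11 (\<omega> c x))"

definition zero_form :: "('a \<Rightarrow> real) \<Rightarrow> ('a, 'n::{finite,linorder}) form"
  where "zero_form f = (\<lambda>c x. axis ({}, {}) (complex_of_real (f x)))"

definition wedge ::
    "('a, 'n::{finite,linorder}) form \<Rightarrow> ('a, 'n) form \<Rightarrow> ('a, 'n) form"
    (infixr \<open>\<^bold>\<and>\<close> 70)
  where "u \<^bold>\<and> v = (\<lambda>c x. ext_wedge (u c x) (v c x))"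

definition cmult :: "complex \<Rightarrow> ('a, 'n::{finite,linorder}) form \<Rightarrow> ('a, 'n) form"
    (infixr \<open>\<cdot>\<close> 75)
  where "a \<cdot> u = (\<lambda>c x. a *s u c x)"

definition fmult :: "('a \<Rightarrow> real) \<Rightarrow> ('a, 'n::{finite,linorder}) form \<Rightarrow> ('a, 'n) form"
    (infixr \<open>\<odot>\<close> 75)
  where "f \<odot> u = (\<lambda>c x. complex_of_real (f x) *s u c x)"

definition conj_form :: "('a, 'n::{finite,linorder}) form \<Rightarrow> ('a, 'n) form"
  where "conj_form u = (\<lambda>c x. ext_cnj (u c x))"

definition del :: "('a, 'n::{finite,linorder}) form \<Rightarrow> ('a, 'n) form"
  where "del u = (\<lambda>c x. \<Sum>j\<in>UNIV. ext_wedge (dz j) (wirt j (u c \<circ> param c) (coord c x)))"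

definition delbar :: "('a, 'n::{finite,linorder}) form \<Rightarrow> ('a, 'n) form"
  where "delbar u = (\<lambda>c x. \<Sum>j\<in>UNIV. ext_wedge (dzbar j) (wirtbar j (u c \<circ> param c) (coord c x)))"

definition Lambda ::
    "('a, 'n::{finite,linorder}) form \<Rightarrow> ('a, 'n) form \<Rightarrow> ('a, 'n) form"
  where "Lambda \<omega> u = (\<lambda>c x. ext_Lambda (\<omega> c x) (u c x))"


section \<open>The twisted operators\<close>

text \<open>Multiplies the component of bidegree \<open>(p, q)\<close> by \<open>p\<close>.\<close>
definition p_weight :: "('a, 'n::{finite,linorder}) form \<Rightarrow> ('a, 'n) form"
  where "p_weight u = (\<lambda>c x. \<chi> s. of_nat (card (fst s)) * u c x $ s)"

text \<open>
  On \<open>(p, q)\<close>-forms, \<open>D01 \<eta>\<close> is \<open>delbar - (p / \<eta>) (delbar \<eta>) \<and> _\<close>; \<open>p_weight\<close> extends this additively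
  to forms of mixed bidegree.
\<close>
definition D01 :: "('a \<Rightarrow> real) \<Rightarrow> ('a, 'n::{finite,linorder}) form \<Rightarrow> ('a, 'n) form"
  where "D01 \<eta> u = delbar u - (\<lambda>x. 1 / \<eta> x) \<odot> (delbar (zero_form \<eta>) \<^bold>\<and> p_weight u)"

definition D01_conj :: "('a \<Rightarrow> real) \<Rightarrow> ('a, 'n::{finite,linorder}) form \<Rightarrow> ('a, 'n) form"
  where "D01_conj \<eta> u = conj_form (D01 \<eta> (conj_form u))"

text \<open>The graded commutator of an operator \<open>P\<close> of degree \<open>a\<close> and an operator \<open>Q\<close> of degree \<open>b\<close>.\<close>
definition gcomm :: "int \<Rightarrow> int \<Rightarrow>
    (('a, 'n::{finite,linorder}) form \<Rightarrow> ('a, 'n) form) \<Rightarrow>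
    (('a, 'n) form \<Rightarrow> ('a, 'n) form) \<Rightarrow> ('a, 'n) form \<Rightarrow> ('a, 'n) form"
  where "gcomm a b P Q = (\<lambda>u. P (Q u) - ((- 1) powi (a * b)) \<cdot> Q (P u))"

end

theory Submission
  imports Defs
begin

text \<open>
  Everything is checked in a single chart. There \<open>\<partial>\<close> and its conjugate are first-order operators
  \<open>\<Sum>\<^sub>b \<sigma>(b) \<and> D\<^sub>b\<close> whose symbols \<open>\<sigma>\<close> are constant one-forms, so they anticommute by the symmetry of
  second derivatives and obey the graded Leibniz rule; expanding the twisted operators with these two
  rules gives the formula for the commutator and both identities in (ii). The formula for the bracket
  with \<open>\<Lambda>\<close> follows by applying the commutator formula to \<open>u\<close> and to \<open>\<Lambda> u\<close>, as \<open>\<Lambda>\<close> preserves \<open>p - q\<close>.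
  This needs \<open>\<Lambda>\<close> to be well defined and to preserve smoothness: the Laplace expansion of minors shows
  that the adjoint of \<open>dz\<^sub>k \<and> \<sqdot>\<close> is a contraction, so \<open>\<Lambda>\<close> is a double contraction with coefficients
  rational in those of the metric, and by induction on the degree that the inner product is
  nondegenerate.
\<close>

section \<open>The exterior algebra\<close>

text \<open>The adjoint is given by a definite description over an inner product written in
  coordinates, where the basis is in general not orthonormal. Pointwise orthonormal coframes would
  simplify the algebra but say nothing about how the adjoint depends on the point, while
  \<open>\<Lambda> u\<close> has to be differentiated twice. So the metric stays in coordinates:
  \<open>lower\<close> reduces its inner product to the standard one, where adjoints of wedge
  multiplications are visible, and intertwining rules carry them back. The bracket with
  \<open>\<Lambda>\<close> comes out cleanly because the bidegree enters the commutator only through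
  p - q. Each composition alone has coefficients quadratic in p and q, since the inner operator
  shifts the weight seen by the outer one; in the sum of the two compositions the products p q
  cancel, and the first-order coefficients lose all dependence on p and q.\<close>

lemma inversions_Un_left:
  assumes "I \<inter> I' = {}"
  shows "inversions (I \<union> I') K = inversions I K + inversions I' K"
proof -
  have "{(i, k). i \<in> I \<union> I' \<and> k \<in> K \<and> k < i} =
      {(i, k). i \<in> I \<and> k \<in> K \<and> k < i} \<union> {(i, k). i \<in> I' \<and> k \<in> K \<and> k < i}"
    by auto
  then show ?thesis
    unfolding inversions_def using assms by (subst card_Un_disjoint[symmetric]) auto
qed

lemma inversions_Un_right:
  assumes "K \<inter> K' = {}"
  shows "inversions I (K \<union> K') = inversions I K + inversions I K'"
proof -
  have "{(i, k). i \<in> I \<and> k \<in> K \<union> K' \<and> k < i} =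
      {(i, k). i \<in> I \<and> k \<in> K \<and> k < i} \<union> {(i, k). i \<in> I \<and> k \<in> K' \<and> k < i}"
    by auto
  then show ?thesis
    unfolding inversions_def using assms by (subst card_Un_disjoint[symmetric]) auto
qed

lemma inversions_empty [simp]: "inversions {} K = 0" "inversions I {} = 0"
  by (simp_all add: inversions_def)

text \<open>Since \<open>I\<close> and \<open>K\<close> are disjoint, each pair in their product is
  inverted in exactly one of the two orders.\<close>

lemma inversions_swap:
  assumes "I \<inter> K = {}"
  shows "inversions I K + inversions K I = card I * card K"
proof -
  have "card {(i, k). i \<in> K \<and> k \<in> I \<and> k < i} = card {(i, k). i \<in> I \<and> k \<in> K \<and> i < k}"
    by (rule bij_betw_same_card[where f = prod.swap]) (auto simp: bij_betw_def inj_on_def image_iff)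
  then have "inversions I K + inversions K I =
      card ({(i, k). i \<in> I \<and> k \<in> K \<and> k < i} \<union> {(i, k). i \<in> I \<and> k \<in> K \<and> i < k})"
    unfolding inversions_def by (subst card_Un_disjoint) auto
  also have "{(i, k). i \<in> I \<and> k \<in> K \<and> k < i} \<union> {(i, k). i \<in> I \<and> k \<in> K \<and> i < k} = I \<times> K"
    using assms by (auto simp: not_less)
  finally show ?thesis by simp
qed

lemma minus_one_power_cong: "even (a + b) \<Longrightarrow> (-1 :: 'a::ring_1) ^ a = (-1) ^ b"
  by (simp add: minus_one_power_iff)

text \<open>The sign is isolated as a function of the two multi-indices so that the laws of the
  wedge product reduce to parity identities for it.\<close>

definition wedge_sign :: "'n::{finite,linorder} set \<times> 'n set \<Rightarrow> 'n set \<times> 'n set \<Rightarrow> complex"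
  where "wedge_sign s t = (-1) ^ (card (snd s) * card (fst t)
    + inversions (fst s) (fst t) + inversions (snd s) (snd t))"

lemma ext_wedge_nth:
  "ext_wedge a b $ (M, N) = (\<Sum>s\<in>Pow M \<times> Pow N.
    wedge_sign s (M - fst s, N - snd s) * a $ s * b $ (M - fst s, N - snd s))"
  by (simp add: ext_wedge_def sum.cartesian_product wedge_sign_def case_prod_beta)

text \<open>A cocycle identity: the exponent is additive in each argument on disjoint unions, so
  both sides collect the same three pairwise contributions.\<close>

lemma wedge_sign_assoc:
  assumes "fst s \<inter> fst t = {}" "snd s \<inter> snd t = {}" "fst t \<inter> fst r = {}" "snd t \<inter> snd r = {}"
    "fst s \<inter> fst r = {}" "snd s \<inter> snd r = {}"
  shows "wedge_sign (fst s \<union> fst t, snd s \<union> snd t) r * wedge_sign s t =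
    wedge_sign s (fst t \<union> fst r, snd t \<union> snd r) * wedge_sign t r"
  using assms unfolding wedge_sign_def
  by (simp add: inversions_Un_left inversions_Un_right card_Un_disjoint algebra_simps
      flip: power_add)

text \<open>Both sides run over the splittings of \<open>(M, N)\<close> into three disjoint pieces
  s, t, r. The left side records a splitting by s \<union> t and s, the right side by s and t; the
  cocycle identity matches the signs.\<close>

lemma ext_wedge_assoc: "ext_wedge (ext_wedge a b) c = ext_wedge a (ext_wedge b c)"
proof -
  have "ext_wedge (ext_wedge a b) c $ (M, N) = ext_wedge a (ext_wedge b c) $ (M, N)" for M N
  proof -
    let ?A = "SIGMA S:Pow M \<times> Pow N. Pow (fst S) \<times> Pow (snd S)"
    let ?B = "SIGMA s:Pow M \<times> Pow N. Pow (M - fst s) \<times> Pow (N - snd s)"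
    have "ext_wedge (ext_wedge a b) c $ (M, N) = (\<Sum>S\<in>Pow M \<times> Pow N. \<Sum>s\<in>Pow (fst S) \<times> Pow (snd S).
        wedge_sign S (M - fst S, N - snd S) * wedge_sign s (fst S - fst s, snd S - snd s)
          * (a $ s * b $ (fst S - fst s, snd S - snd s) * c $ (M - fst S, N - snd S)))"
      unfolding ext_wedge_nth[of "ext_wedge a b"]
    proof (rule sum.cong[OF refl], goal_cases)
      case (1 S)
      show ?case
        by (cases S) (simp add: ext_wedge_nth sum_distrib_left sum_distrib_right mult.assoc)
    qed
    also have "\<dots> = (\<Sum>x\<in>?A. case x of (S, s) \<Rightarrow>
        wedge_sign S (M - fst S, N - snd S) * wedge_sign s (fst S - fst s, snd S - snd s)
          * (a $ s * b $ (fst S - fst s, snd S - snd s) * c $ (M - fst S, N - snd S)))"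
      by (rule sum.Sigma) auto
    also have "\<dots> = (\<Sum>x\<in>?B. case x of (s, t) \<Rightarrow>
        wedge_sign s (M - fst s, N - snd s) * wedge_sign t (M - fst s - fst t, N - snd s - snd t)
          * (a $ s * b $ t * c $ (M - fst s - fst t, N - snd s - snd t)))"
    proof (rule sum.reindex_bij_witness[where
          j = "\<lambda>(S, s). (s, (fst S - fst s, snd S - snd s))" and
          i = "\<lambda>(s, t). ((fst s \<union> fst t, snd s \<union> snd t), s)"], goal_cases)
      case (5 x)
      obtain S s where x: "x = (S, s)" by (cases x)
      have mem: "fst s \<subseteq> fst S" "snd s \<subseteq> snd S" "fst S \<subseteq> M" "snd S \<subseteq> N"
        using 5 x by auto
      let ?t = "(fst S - fst s, snd S - snd s)" and ?r = "(M - fst S, N - snd S)"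
      have eq: "(fst s \<union> fst ?t, snd s \<union> snd ?t) = S"
          "(fst ?t \<union> fst ?r, snd ?t \<union> snd ?r) = (M - fst s, N - snd s)"
          "M - fst s - (fst S - fst s) = M - fst S" "N - snd s - (snd S - snd s) = N - snd S"
        using mem by (auto simp: prod_eq_iff)
      have "wedge_sign S ?r * wedge_sign s ?t = wedge_sign s (M - fst s, N - snd s) * wedge_sign ?t ?r"
        using wedge_sign_assoc[of s ?t ?r] mem unfolding eq by fastforce
      then show ?case
        unfolding x by (simp add: eq)
    qed (auto, blast+)
    also have "\<dots> = (\<Sum>s\<in>Pow M \<times> Pow N. \<Sum>t\<in>Pow (M - fst s) \<times> Pow (N - snd s).
        wedge_sign s (M - fst s, N - snd s) * wedge_sign t (M - fst s - fst t, N - snd s - snd t)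
          * (a $ s * b $ t * c $ (M - fst s - fst t, N - snd s - snd t)))"
      by (rule sum.Sigma[symmetric]) auto
    also have "\<dots> = ext_wedge a (ext_wedge b c) $ (M, N)"
      unfolding ext_wedge_nth[of a]
    proof (rule sum.cong[OF refl], goal_cases)
      case (1 s)
      show ?case
        by (simp add: ext_wedge_nth sum_distrib_left mult_ac)
    qed
    finally show ?thesis .
  qed
  then show ?thesis by (simp add: vec_eq_iff)
qed

definition ext_degree :: "nat \<Rightarrow> 'n::{finite,linorder} ext \<Rightarrow> bool"
  where "ext_degree k a \<longleftrightarrow> (\<forall>I J. a $ (I, J) \<noteq> 0 \<longrightarrow> card I + card J = k)"

text \<open>Each splitting is paired with its complement. Inversions counted in both orders add up
  to products of cardinalities, so the exponents of the two signs together with \<open>k * l\<close>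
  have an even sum.\<close>

lemma ext_wedge_commute:
  assumes "ext_degree k a" "ext_degree l b"
  shows "ext_wedge a b = (-1) ^ (k * l) *s ext_wedge b a"
proof -
  have "ext_wedge a b $ (M, N) = (-1) ^ (k * l) * ext_wedge b a $ (M, N)" for M N
  proof -
    have "ext_wedge a b $ (M, N) = (\<Sum>s\<in>Pow M \<times> Pow N. (-1) ^ (k * l) *
        (wedge_sign s (M - fst s, N - snd s) * b $ s * a $ (M - fst s, N - snd s)))"
      unfolding ext_wedge_nth
    proof (rule sum.reindex_bij_witness[where
          j = "\<lambda>s. (M - fst s, N - snd s)" and i = "\<lambda>s. (M - fst s, N - snd s)"], goal_cases)
      case (5 s)
      obtain I J where s: "s = (I, J)" by (cases s)
      have mem: "M - (M - I) = I" "N - (N - J) = J" using 5 s by auto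
      show ?case
      proof (cases "a $ (I, J) = 0 \<or> b $ (M - I, N - J) = 0")
        case False
        then have deg: "k = card I + card J" "l = card (M - I) + card (N - J)"
          using assms by (auto simp: ext_degree_def)
        have "(-1) ^ (k * l) * wedge_sign (M - I, N - J) (I, J) =
            wedge_sign (I, J) (M - I, N - J)"
        proof -
          have 1: "inversions (M - I) I + inversions I (M - I) = card (M - I) * card I"
            "inversions (N - J) J + inversions J (N - J) = card (N - J) * card J"
            by (rule inversions_swap; auto)+
          have "even (k * l + (card (N - J) * card I + inversions (M - I) I + inversions (N - J) J)
              + (card J * card (M - I) + inversions I (M - I) + inversions J (N - J)))"
          proof -
            have "k * l + (card (N - J) * card I + inversions (M - I) I + inversions (N - J) J)
              + (card J * card (M - I) + inversions I (M - I) + inversions J (N - J)) =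
              k * l + (card (N - J) * card I + card J * card (M - I))
                + (inversions (M - I) I + inversions I (M - I))
                + (inversions (N - J) J + inversions J (N - J))"
              by simp
            also have "\<dots> = 2 * (card I * card (M - I) + card I * card (N - J)
                + card J * card (M - I) + card J * card (N - J))"
              unfolding 1 deg by (simp add: algebra_simps)
            finally show ?thesis by (simp only: dvd_triv_left)
          qed
          then show ?thesis
            unfolding wedge_sign_def fst_conv snd_conv power_add[symmetric]
            by (rule minus_one_power_cong)
        qed
        then show ?thesis
          unfolding s by (simp add: mem)
      qed (auto simp: s mem)
    qed auto
    then show ?thesis
      by (simp add: ext_wedge_nth sum_distrib_left)
  qed
  then show ?thesis by (simp add: vec_eq_iff)
qed

lemma ext_wedge_add_left: "ext_wedge (a + b) c = ext_wedge a c + ext_wedge b c"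
  by (auto simp: vec_eq_iff ext_wedge_nth sum.distrib algebra_simps)

lemma ext_wedge_add_right: "ext_wedge a (b + c) = ext_wedge a b + ext_wedge a c"
  by (auto simp: vec_eq_iff ext_wedge_nth sum.distrib algebra_simps)

lemma ext_wedge_smult_left: "ext_wedge (r *s a) c = r *s ext_wedge a c"
  by (auto simp: vec_eq_iff ext_wedge_nth sum_distrib_left intro!: sum.cong)

lemma ext_wedge_smult_right: "ext_wedge a (r *s c) = r *s ext_wedge a c"
  by (auto simp: vec_eq_iff ext_wedge_nth sum_distrib_left intro!: sum.cong)

lemma ext_wedge_zero [simp]: "ext_wedge 0 a = 0" "ext_wedge a 0 = 0"
  by (simp_all add: vec_eq_iff ext_wedge_nth)

lemma ext_wedge_minus_left: "ext_wedge (- a) b = - ext_wedge a b"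
  by (simp add: vec_eq_iff ext_wedge_nth sum_negf)

lemma ext_wedge_minus_right: "ext_wedge a (- b) = - ext_wedge a b"
  by (simp add: vec_eq_iff ext_wedge_nth sum_negf)

lemma ext_wedge_diff_left: "ext_wedge (a - b) c = ext_wedge a c - ext_wedge b c"
  using ext_wedge_add_left[of a "- b" c] by (simp add: ext_wedge_minus_left)

lemma ext_wedge_diff_right: "ext_wedge a (b - c) = ext_wedge a b - ext_wedge a c"
  using ext_wedge_add_right[of a b "- c"] by (simp add: ext_wedge_minus_right)

lemma ext_wedge_sum_left: "ext_wedge (\<Sum>i\<in>I. f i) a = (\<Sum>i\<in>I. ext_wedge (f i) a)"
  by (induction I rule: infinite_finite_induct) (auto simp: ext_wedge_add_left)

lemma ext_wedge_sum_right: "ext_wedge a (\<Sum>i\<in>I. f i) = (\<Sum>i\<in>I. ext_wedge a (f i))"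
  by (induction I rule: infinite_finite_induct) (auto simp: ext_wedge_add_right)

lemma one_form_anticommute:
  assumes "ext_degree 1 a" "ext_degree 1 b"
  shows "ext_wedge a (ext_wedge b c) = - ext_wedge b (ext_wedge a c)"
  using ext_wedge_commute[OF assms]
  by (simp add: ext_wedge_minus_left flip: ext_wedge_assoc)

lemma scaleR_eq_smult: "r *\<^sub>R (v :: complex ^ 'm) = complex_of_real r *s v"
  by (subst vec_eq_iff) (simp add: complex_eq_iff)

lemma bounded_bilinear_ext_wedge: "bounded_bilinear ext_wedge"
  unfolding bilinear_conv_bounded_bilinear[symmetric] bilinear_def
  by (auto intro!: linearI simp: ext_wedge_add_left ext_wedge_add_right scaleR_eq_smult
      ext_wedge_smult_left ext_wedge_smult_right)

lemma ext_wedge_scalar_right [simp]: "ext_wedge a (axis ({}, {}) r) = r *s a"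
proof -
  have "ext_wedge a (axis ({}, {}) r) $ (M, N) = r * a $ (M, N)" for M N
  proof -
    have "ext_wedge a (axis ({}, {}) r) $ (M, N) =
        (\<Sum>s\<in>Pow M \<times> Pow N. if s = (M, N) then r * a $ (M, N) else 0)"
      unfolding ext_wedge_nth by (rule sum.cong) (auto simp: axis_def wedge_sign_def)
    then show ?thesis by simp
  qed
  then show ?thesis by (simp add: vec_eq_iff)
qed

lemma ext_wedge_dz_nth:
  "ext_wedge (dz k) a $ (M, N) =
    (if k \<in> M then (-1) ^ inversions {k} (M - {k}) * a $ (M - {k}, N) else 0)"
proof -
  have "ext_wedge (dz k) a $ (M, N) = (\<Sum>s\<in>Pow M \<times> Pow N.
      if s = ({k}, {}) then (-1) ^ inversions {k} (M - {k}) * a $ (M - {k}, N) else 0)"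
    unfolding ext_wedge_nth dz_def by (rule sum.cong) (auto simp: axis_def wedge_sign_def)
  then show ?thesis by simp
qed

text \<open>Only the splitting that takes \<open>dzbar k\<close> alone contributes. The extra
  \<open>card M\<close> in the sign counts the holomorphic factors that \<open>dzbar k\<close> has
  to pass.\<close>

lemma ext_wedge_dzbar_nth:
  "ext_wedge (dzbar k) a $ (M, N) =
    (if k \<in> N then (-1) ^ (card M + inversions {k} (N - {k})) * a $ (M, N - {k}) else 0)"
proof -
  have "ext_wedge (dzbar k) a $ (M, N) = (\<Sum>s\<in>Pow M \<times> Pow N.
      if s = ({}, {k}) then (-1) ^ (card M + inversions {k} (N - {k})) * a $ (M, N - {k}) else 0)"
    unfolding ext_wedge_nth dzbar_def by (rule sum.cong) (auto simp: axis_def wedge_sign_def)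
  then show ?thesis by simp
qed

lemma dz_wedge_dzbar: "ext_wedge (dz j) (dzbar k) = axis ({j}, {k}) 1"
proof -
  have "ext_wedge (dz j) (dzbar k) $ (M, N) = axis ({j}, {k}) 1 $ (M, N)" for M N
    unfolding ext_wedge_dz_nth by (auto simp: dzbar_def axis_def)
  then show ?thesis by (simp add: vec_eq_iff)
qed

section \<open>Degrees and bidegrees of exterior forms\<close>

lemma ext_degree_smult: "ext_degree k a \<Longrightarrow> ext_degree k (r *s a)"
  unfolding ext_degree_def by (metis mult_zero_right vector_smult_component)

lemma ext_degree_add: "ext_degree k a \<Longrightarrow> ext_degree k b \<Longrightarrow> ext_degree k (a + b)"
  unfolding ext_degree_def by (metis add_0 vector_add_component)

lemma ext_degree_sum: "(\<And>i. i \<in> I \<Longrightarrow> ext_degree k (f i)) \<Longrightarrow> ext_degree k (\<Sum>i\<in>I. f i)"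
proof (induction I rule: infinite_finite_induct)
  case (insert x F)
  then show ?case by (simp add: ext_degree_add)
qed (simp_all add: ext_degree_def)

definition ext_bidegree :: "nat \<Rightarrow> nat \<Rightarrow> 'n::{finite,linorder} ext \<Rightarrow> bool"
  where "ext_bidegree p q a \<longleftrightarrow> (\<forall>I J. a $ (I, J) \<noteq> 0 \<longrightarrow> card I = p \<and> card J = q)"

lemma ext_bidegree_degree: "ext_bidegree p q a \<Longrightarrow> ext_degree (p + q) a"
  by (auto simp: ext_bidegree_def ext_degree_def)

lemma ext_bidegree_dz: "ext_bidegree 1 0 (dz k)"
  by (auto simp: ext_bidegree_def dz_def axis_def)

lemma ext_bidegree_dzbar: "ext_bidegree 0 1 (dzbar k)"
  by (auto simp: ext_bidegree_def dzbar_def axis_def)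

lemma ext_bidegree_zero: "ext_bidegree p q 0"
  by (simp add: ext_bidegree_def)

lemma ext_bidegree_add: "ext_bidegree p q a \<Longrightarrow> ext_bidegree p q b \<Longrightarrow> ext_bidegree p q (a + b)"
  unfolding ext_bidegree_def by (metis add_0 vector_add_component)

lemma ext_bidegree_smult: "ext_bidegree p q a \<Longrightarrow> ext_bidegree p q (r *s a)"
  unfolding ext_bidegree_def by (metis mult_zero_right vector_smult_component)

lemma ext_bidegree_diff: "ext_bidegree p q a \<Longrightarrow> ext_bidegree p q b \<Longrightarrow> ext_bidegree p q (a - b)"
  unfolding ext_bidegree_def by (metis diff_0_right vector_minus_component)

lemma ext_bidegree_sum: "(\<And>i. i \<in> I \<Longrightarrow> ext_bidegree p q (f i)) \<Longrightarrow> ext_bidegree p q (\<Sum>i\<in>I. f i)"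
  by (induction I rule: infinite_finite_induct) (auto simp: ext_bidegree_add ext_bidegree_zero)

lemma ext_bidegree_wedge:
  assumes "ext_bidegree p q a" "ext_bidegree r s b"
  shows "ext_bidegree (p + r) (q + s) (ext_wedge a b)"
  unfolding ext_bidegree_def
proof (intro allI impI)
  fix M N assume "ext_wedge a b $ (M, N) \<noteq> 0"
  then obtain I J where "I \<subseteq> M" "J \<subseteq> N" "a $ (I, J) \<noteq> 0" "b $ (M - I, N - J) \<noteq> 0"
    unfolding ext_wedge_nth by (metis (no_types, lifting) SigmaE Pow_iff fst_conv snd_conv
        mult_eq_0_iff sum.neutral)
  with assms have "card I = p" "card (M - I) = r" "card J = q" "card (N - J) = s"
    unfolding ext_bidegree_def by blast+
  moreover have "card M = card I + card (M - I)" "card N = card J + card (N - J)"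
    using \<open>I \<subseteq> M\<close> \<open>J \<subseteq> N\<close> card_Un_disjoint[of I "M - I"] card_Un_disjoint[of J "N - J"]
    by (simp_all add: Un_absorb1)
  ultimately show "card M = p + r \<and> card N = q + s" by simp
qed

section \<open>Complex conjugation of exterior forms\<close>

lemma ext_cnj_nth: "ext_cnj a $ (I, J) = (-1) ^ (card I * card J) * cnj (a $ (J, I))"
  by (simp add: ext_cnj_def)

text \<open>Splitting M and N expands \<open>card M * card N\<close> into four products. Two are the
  conjugation signs of the factors; of the other two, one cancels the old interleaving sign and one
  supplies the new one.\<close>

lemma ext_cnj_wedge: "ext_cnj (ext_wedge a b) = ext_wedge (ext_cnj a) (ext_cnj b)"
proof -
  have "ext_cnj (ext_wedge a b) $ (M, N) = ext_wedge (ext_cnj a) (ext_cnj b) $ (M, N)" for M N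
  proof -
    have "ext_cnj (ext_wedge a b) $ (M, N) = (\<Sum>s\<in>Pow N \<times> Pow M. (-1) ^ (card M * card N) *
        cnj (wedge_sign s (N - fst s, M - snd s) * a $ s * b $ (N - fst s, M - snd s)))"
      by (simp add: ext_cnj_nth ext_wedge_nth sum_distrib_left)
    also have "\<dots> = ext_wedge (ext_cnj a) (ext_cnj b) $ (M, N)"
      unfolding ext_wedge_nth
    proof (rule sum.reindex_bij_witness[where j = prod.swap and i = prod.swap], goal_cases)
      case (5 s)
      obtain I J where s: "s = (I, J)" by (cases s)
      have *: "card M = card J + card (M - J)" "card N = card I + card (N - I)"
        using 5 s card_Un_disjoint[of I "N - I"] card_Un_disjoint[of J "M - J"]
        by (simp_all add: Un_absorb1)
      have "(-1) ^ (card M * card N) * cnj (wedge_sign (I, J) (N - I, M - J)) =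
          wedge_sign (J, I) (M - J, N - I) * (-1) ^ (card I * card J)
            * (-1) ^ (card (M - J) * card (N - I))"
        unfolding * wedge_sign_def complex_cnj_power complex_cnj_minus complex_cnj_one
          fst_conv snd_conv power_add[symmetric]
        by (rule minus_one_power_cong) (simp add: algebra_simps)
      then show ?case
        by (simp add: s ext_cnj_nth mult_ac)
    qed auto
    finally show ?thesis .
  qed
  then show ?thesis by (simp add: vec_eq_iff)
qed

lemma ext_cnj_cnj [simp]: "ext_cnj (ext_cnj a) = a"
proof -
  have "ext_cnj (ext_cnj a) $ (I, J) = a $ (I, J)" for I J
    by (simp add: ext_cnj_nth mult.commute[of "card J"] flip: mult.assoc power_mult_distrib)
  then show ?thesis by (simp add: vec_eq_iff)
qed

lemma ext_cnj_add: "ext_cnj (a + b) = ext_cnj a + ext_cnj b"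
  by (auto simp: vec_eq_iff ext_cnj_nth algebra_simps)

lemma ext_cnj_diff: "ext_cnj (a - b) = ext_cnj a - ext_cnj b"
  by (auto simp: vec_eq_iff ext_cnj_nth algebra_simps)

lemma ext_cnj_smult: "ext_cnj (r *s a) = cnj r *s ext_cnj a"
  by (auto simp: vec_eq_iff ext_cnj_nth)

lemma ext_cnj_sum: "ext_cnj (\<Sum>i\<in>I. f i) = (\<Sum>i\<in>I. ext_cnj (f i))"
proof -
  have "ext_cnj 0 = (0 :: 'n::{finite,linorder} ext)" by (auto simp: vec_eq_iff ext_cnj_nth)
  then show ?thesis
    by (induction I rule: infinite_finite_induct) (auto simp: ext_cnj_add)
qed

lemma ext_cnj_dzbar: "ext_cnj (dzbar k) = dz k"
  by (auto simp: vec_eq_iff ext_cnj_nth dz_def dzbar_def axis_def)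

lemma bounded_linear_ext_cnj: "bounded_linear ext_cnj"
  unfolding linear_conv_bounded_linear[symmetric]
  by (intro linearI) (auto simp: ext_cnj_add scaleR_eq_smult ext_cnj_smult)

lemma ext_bidegree_cnj: "ext_bidegree p q a \<Longrightarrow> ext_bidegree q p (ext_cnj a)"
  by (auto simp: ext_bidegree_def ext_cnj_nth)

section \<open>Laplace expansion of minors\<close>

abbreviation insert_sign :: "'n::{finite,linorder} \<Rightarrow> 'n set \<Rightarrow> complex"
  where "insert_sign i I \<equiv> (-1) ^ inversions {i} I"

lemma minor_card: "minor M I K \<noteq> 0 \<Longrightarrow> card I = card K"
proof -
  assume "minor M I K \<noteq> 0"
  then obtain f where "bij_betw f I K"
    unfolding minor_def by (metis (mono_tags, lifting) mem_Collect_eq sum.neutral)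
  then show ?thesis by (rule bij_betw_same_card)
qed

lemma minor_empty_right:
  fixes I :: "'n::{finite,linorder} set"
  shows "minor M I {} = (if I = {} then 1 else 0)"
proof (cases "I = {}")
  case True
  \<comment> \<open>The Leibniz sum has one term here, the extensional function on the empty set,
    which is \<open>undefined\<close> everywhere.\<close>
  have "{f. f \<in> extensional {} \<and> bij_betw f {} {}} = {\<lambda>_ :: 'n. undefined :: 'n}"
    by (auto simp: bij_betw_def)
  then show ?thesis unfolding minor_def True by simp
next
  case False
  then have "card I \<noteq> card ({} :: 'n set)" by simp
  with False show ?thesis using minor_card by metis
qed

text \<open>Compares the sign of a bijection with that of its restriction away from
  \<open>i\<close>. Let A be the positions before \<open>i\<close> and B the positions whose value
  lies below \<open>f i\<close>. The inversions involving \<open>i\<close> correspond to the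
  symmetric difference of A and B, whose size has the parity of \<open>card A + card B\<close>;
  these two numbers are the insertion exponents of \<open>i\<close> and \<open>f i\<close>.\<close>

lemma card_inversions_fun_upd:
  fixes f :: "'n::{finite,linorder} \<Rightarrow> 'n"
  assumes f: "bij_betw f I K" and i: "i \<in> I"
  shows "even (card {(a, b). a \<in> I \<and> b \<in> I \<and> a < b \<and> f b < f a} +
    (inversions {i} (I - {i}) + inversions {f i} (K - {f i}) +
     card {(a, b). a \<in> I - {i} \<and> b \<in> I - {i} \<and> a < b \<and> f b < f a}))"
proof -
  define A where "A = {j \<in> I - {i}. j < i}"
  define B where "B = {j \<in> I - {i}. f j < f i}"
  let ?S = "{(a, b). a \<in> I - {i} \<and> b \<in> I - {i} \<and> a < b \<and> f b < f a}"
  have inj: "inj_on f I" and im: "f ` I = K" using f by (auto simp: bij_betw_def)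
  have "{(a, b). a \<in> I \<and> b \<in> I \<and> a < b \<and> f b < f a} =
      (?S \<union> (\<lambda>j. (i, j)) ` (B - A)) \<union> (\<lambda>j. (j, i)) ` (A - B)" (is "_ = ?R")
  proof (rule set_eqI)
    fix x :: "'n \<times> 'n"
    obtain a b where x: "x = (a, b)" by (cases x)
    have ne: "f j \<noteq> f i" if "j \<in> I" "j \<noteq> i" for j using inj i that by (auto dest: inj_onD)
    show "x \<in> {(a, b). a \<in> I \<and> b \<in> I \<and> a < b \<and> f b < f a} \<longleftrightarrow> x \<in> ?R"
      unfolding x A_def B_def using ne[of a] ne[of b] i
      by (cases "a = i"; cases "b = i") (auto simp: image_iff)
  qed
  then have "card {(a, b). a \<in> I \<and> b \<in> I \<and> a < b \<and> f b < f a} =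
      card (?S \<union> (\<lambda>j. (i, j)) ` (B - A)) + card ((\<lambda>j. (j, i)) ` (A - B))"
    by (simp only:) (rule card_Un_disjoint; auto simp: A_def B_def)
  also have "card (?S \<union> (\<lambda>j. (i, j)) ` (B - A)) = card ?S + card ((\<lambda>j. (i, j)) ` (B - A))"
    by (rule card_Un_disjoint; auto simp: A_def B_def)
  also have "card ((\<lambda>j. (i, j)) ` (B - A)) = card (B - A)"
    by (rule card_image) (auto simp: inj_on_def)
  also have "card ((\<lambda>j. (j, i)) ` (A - B)) = card (A - B)"
    by (rule card_image) (auto simp: inj_on_def)
  finally have 1: "card {(a, b). a \<in> I \<and> b \<in> I \<and> a < b \<and> f b < f a} =
      card ?S + card (B - A) + card (A - B)" .
  have "inversions {i} (I - {i}) = card ((\<lambda>j. (i, j)) ` A)"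
    unfolding inversions_def A_def by (rule arg_cong[where f = card]) auto
  then have 2: "inversions {i} (I - {i}) = card A"
    by (simp add: card_image inj_on_def)
  have "K - {f i} = f ` (I - {i})" using inj im i by (auto simp: inj_on_def)
  then have "inversions {f i} (K - {f i}) = card ((\<lambda>j. (f i, f j)) ` B)"
    unfolding inversions_def B_def by (intro arg_cong[where f = card]) auto
  moreover have "inj_on (\<lambda>j. (f i, f j)) B" using inj by (auto simp: inj_on_def B_def)
  ultimately have 3: "inversions {f i} (K - {f i}) = card B"
    by (simp add: card_image)
  have "card A = card (A - B) + card (A \<inter> B)" "card B = card (B - A) + card (A \<inter> B)"
    using card_Int_Diff[of A B] card_Int_Diff[of B A] by (simp_all add: Int_commute)
  then have "card ?S + card (B - A) + card (A - B) + (card A + card B + card ?S) =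
      2 * (card ?S + card (B - A) + card (A - B) + card (A \<inter> B))"
    by (simp only: mult_2 add_ac)
  then show ?thesis unfolding 1 2 3 by (simp only: dvd_triv_left)
qed

text \<open>Expansion along column \<open>k\<close>: a bijection onto \<open>K\<close> amounts to
  the preimage i of \<open>k\<close> together with a bijection of the remaining rows and
  columns.\<close>

lemma minor_Laplace:
  assumes k: "k \<in> K"
  shows "minor M I K = (\<Sum>i\<in>I. insert_sign i (I - {i}) * insert_sign k (K - {k}) * M $ i $ k
    * minor M (I - {i}) (K - {k}))"
proof -
  let ?F = "\<lambda>I K. {f. f \<in> extensional I \<and> bij_betw f I K}"
  let ?c = "\<lambda>f I. (-1 :: complex) ^ card {(i, j). i \<in> I \<and> j \<in> I \<and> i < j \<and> f j < f i} * (\<Prod>i\<in>I. M $ i $ f i)"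
  have "minor M I K = (\<Sum>x\<in>(SIGMA i:I. ?F (I - {i}) (K - {k})). case x of (i, g) \<Rightarrow>
      insert_sign i (I - {i}) * insert_sign k (K - {k}) * M $ i $ k * ?c g (I - {i}))"
    unfolding minor_def
  proof (rule sum.reindex_bij_witness[where
        j = "\<lambda>f. (inv_into I f k, restrict f (I - {inv_into I f k}))" and
        i = "\<lambda>(i, g). g(i := k)"], goal_cases)
    case (1 f)
    then have "f (inv_into I f k) = k" using k by (auto simp: bij_betw_def f_inv_into_f)
    with 1 show ?case by (auto simp: fun_eq_iff extensional_def)
  next
    case (2 f)
    define i where "i = inv_into I f k"
    have f: "f i = k" "i \<in> I" "inj_on f I" "f ` I = K"
      using 2 k by (auto simp: bij_betw_def f_inv_into_f i_def intro: inv_into_into)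
    then have "bij_betw (restrict f (I - {i})) (I - {i}) (K - {k})"
      by (auto simp: bij_betw_def inj_on_def)
    with f show ?case unfolding i_def[symmetric] by auto
  next
    case (3 x)
    obtain i g where x: "x = (i, g)" by (cases x)
    have g: "i \<in> I" "g \<in> extensional (I - {i})" "inj_on g (I - {i})" "g ` (I - {i}) = K - {k}"
      using 3 x by (auto simp: bij_betw_def)
    have "inj_on (g(i := k)) I"
      using g by (auto simp: inj_on_def)
    then have "inv_into I (g(i := k)) k = i"
      using g(1) by (metis fun_upd_same inv_into_f_f)
    with g show ?case by (auto simp: x fun_eq_iff extensional_def)
  next
    case (4 x)
    obtain i g where x: "x = (i, g)" by (cases x)
    have g: "i \<in> I" "g \<in> extensional (I - {i})" "inj_on g (I - {i})" "g ` (I - {i}) = K - {k}"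
      using 4 x by (auto simp: bij_betw_def)
    have "inj_on (g(i := k)) I"
      using g by (auto simp: inj_on_def)
    moreover have "(g(i := k)) ` I = insert k (g ` (I - {i}))"
      using g(1) by auto
    ultimately show ?case
      using g k by (auto simp: x bij_betw_def extensional_def)
  next
    case (5 f)
    define i where "i = inv_into I f k"
    define g where "g = restrict f (I - {i})"
    have f: "f i = k" "i \<in> I" "bij_betw f I K"
      using 5 k by (auto simp: bij_betw_def f_inv_into_f i_def intro: inv_into_into)
    have "{(a, b). a \<in> I - {i} \<and> b \<in> I - {i} \<and> a < b \<and> g b < g a} =
        {(a, b). a \<in> I - {i} \<and> b \<in> I - {i} \<and> a < b \<and> f b < f a}"
      by (auto simp: g_def)
    moreover have "(\<Prod>j\<in>I. M $ j $ f j) = M $ i $ k * (\<Prod>j\<in>I - {i}. M $ j $ g j)"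
      using f by (simp add: prod.remove[of I i] g_def)
    moreover have "(-1 :: complex) ^ card {(a, b). a \<in> I \<and> b \<in> I \<and> a < b \<and> f b < f a} =
        (-1) ^ (inversions {i} (I - {i}) + inversions {k} (K - {k}) +
          card {(a, b). a \<in> I - {i} \<and> b \<in> I - {i} \<and> a < b \<and> f b < f a})"
      using card_inversions_fun_upd[OF f(3,2)] unfolding f(1) by (rule minus_one_power_cong)
    ultimately show ?case
      by (simp add: power_add flip: i_def g_def)
  qed
  also have "\<dots> = (\<Sum>i\<in>I. \<Sum>g\<in>?F (I - {i}) (K - {k}).
      insert_sign i (I - {i}) * insert_sign k (K - {k}) * M $ i $ k * ?c g (I - {i}))"
    by (rule sum.Sigma[symmetric]) auto
  also have "\<dots> = (\<Sum>i\<in>I. insert_sign i (I - {i}) * insert_sign k (K - {k}) * M $ i $ k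
    * minor M (I - {i}) (K - {k}))"
    by (simp add: minor_def sum_distrib_left)
  finally show ?thesis .
qed

text \<open>For \<open>k \<in> K\<close> the sum expands the minor of a matrix with the column \<open>k\<close> repeated.\<close>
lemma minor_Laplace_insert:
  "(\<Sum>i\<in>I. insert_sign i (I - {i}) * M $ i $ k * minor M (I - {i}) K) =
    (if k \<in> K then 0 else insert_sign k K * minor M I (insert k K))"
proof (cases "k \<in> K")
  case False
  then have "insert_sign k K * minor M I (insert k K) =
      (\<Sum>i\<in>I. (insert_sign k K * insert_sign k K) *
        (insert_sign i (I - {i}) * M $ i $ k * minor M (I - {i}) K))"
    by (subst minor_Laplace[of k]) (auto simp: sum_distrib_left intro!: sum.cong)
  with False show ?thesis by (simp flip: power_mult_distrib)
next
  case True
  \<comment> \<open>\<open>T (i, j)\<close> is the term obtained by expanding along column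
    \<open>k\<close> a second time, now in the remaining minor. It uses the same column for both
    rows, so exchanging i and j changes only the sign, and the sum over ordered pairs equals its own
    negative.\<close>
  define T where "T = (\<lambda>(i, j). insert_sign i (I - {i}) * M $ i $ k *
      (insert_sign j (I - {i} - {j}) * insert_sign k (K - {k}) * M $ j $ k
        * minor M (I - {i} - {j}) (K - {k})))"
  let ?P = "SIGMA i:I. I - {i}"
  have anti: "T (i, j) = - T (j, i)" if "i \<in> I" "j \<in> I" "i \<noteq> j" for i j
  proof -
    have "inversions {i} (I - {i}) = inversions {i} {j} + inversions {i} (I - {i} - {j})"
      "inversions {j} (I - {j}) = inversions {j} {i} + inversions {j} (I - {i} - {j})"
      using that by (subst inversions_Un_right[symmetric]; auto intro!: arg_cong2[where f = inversions])+
    moreover have "inversions {i} {j} + inversions {j} {i} = 1"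
      using inversions_swap[of "{i}" "{j}"] that by simp
    ultimately have "insert_sign i (I - {i}) * insert_sign j (I - {i} - {j}) =
        - (insert_sign j (I - {j}) * insert_sign i (I - {i} - {j}))"
      by (cases "inversions {i} {j}") (simp_all add: power_add)
    moreover have "I - {j} - {i} = I - {i} - {j}" by auto
    ultimately show ?thesis
      by (simp add: T_def) (simp add: mult_ac)
  qed
  have "(\<Sum>i\<in>I. insert_sign i (I - {i}) * M $ i $ k * minor M (I - {i}) K) = (\<Sum>x\<in>?P. T x)"
    by (simp add: minor_Laplace[OF True] T_def sum_distrib_left flip: sum.Sigma)
  moreover
  have "(\<Sum>x\<in>?P. T x) = (\<Sum>x\<in>?P. - T x)"
  proof (rule sum.reindex_bij_witness[where i = prod.swap and j = prod.swap], goal_cases)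
    case (5 x)
    then show ?case using anti[of "fst x" "snd x"] by (cases x) auto
  qed auto
  then have "2 * (\<Sum>x\<in>?P. T x) = 0"
    by (simp only: sum_negf eq_neg_iff_add_eq_0 mult_2)
  ultimately show ?thesis using True by simp
qed

text \<open>Converts a Laplace sum, which removes a row from a set, into a sum over sets lacking
  that row, which is the shape of the coefficients of a contraction.\<close>

lemma sum_set_insert:
  fixes f :: "'n::finite \<Rightarrow> 'n set \<Rightarrow> 'b::comm_monoid_add"
  shows "(\<Sum>I\<in>UNIV. \<Sum>i\<in>I. f i I) = (\<Sum>i\<in>UNIV. \<Sum>I\<in>UNIV. if i \<in> I then 0 else f i (insert i I))"
proof -
  have "(\<Sum>I\<in>UNIV. \<Sum>i\<in>I. f i I) = (\<Sum>I\<in>UNIV. \<Sum>i\<in>{i \<in> UNIV. i \<in> I}. f i I)"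
    by simp
  also have "\<dots> = (\<Sum>i\<in>UNIV. \<Sum>I\<in>{I \<in> UNIV. i \<in> I}. f i I)"
    by (rule sum.swap_restrict) auto
  also have "\<dots> = (\<Sum>i\<in>UNIV. \<Sum>I\<in>{I. i \<notin> I}. f i (insert i I))"
  proof (rule sum.cong[OF refl], goal_cases)
    case (1 i)
    show ?case
      by (rule sum.reindex_bij_witness[where i = "insert i" and j = "\<lambda>I. I - {i}"])
        (auto simp: insert_absorb)
  qed
  also have "\<dots> = (\<Sum>i\<in>UNIV. \<Sum>I\<in>UNIV. if i \<in> I then 0 else f i (insert i I))"
    by (intro sum.cong sum.mono_neutral_cong_left) auto
  finally show ?thesis .
qed

section \<open>Contractions and the adjoint of the Lefschetz operator\<close>

text \<open>The interior product with the k-th holomorphic coordinate vector field. Its sign is the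
  one that makes it adjoint to wedging with \<open>dz k\<close> for \<open>ext_dot\<close>, see
  \<open>ext_dot_dz\<close>.\<close>

definition contr :: "'n::{finite,linorder} \<Rightarrow> 'n ext \<Rightarrow> 'n ext"
  where "contr k a = (\<chi> s. if k \<in> fst s then 0
    else insert_sign k (fst s) * a $ (insert k (fst s), snd s))"

text \<open>The antiholomorphic counterpart, adjoint to wedging with \<open>dzbar k\<close>; the
  power with exponent \<open>card (fst s)\<close> comes from passing the holomorphic
  factors.\<close>

definition contrbar :: "'n::{finite,linorder} \<Rightarrow> 'n ext \<Rightarrow> 'n ext"
  where "contrbar k a = (\<chi> s. if k \<in> snd s then 0
    else (-1) ^ card (fst s) * insert_sign k (snd s) * a $ (fst s, insert k (snd s)))"

text \<open>The coefficients of \<open>\<langle>a, \<sqdot>\<rangle>\<close>, so that \<open>ext_inner w a b\<close> is the standard inner product of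
  \<open>lower (dual_gram w) a\<close> and \<open>b\<close>.\<close>
definition lower :: "'n cmat \<Rightarrow> 'n::{finite,linorder} ext \<Rightarrow> 'n ext"
  where "lower G a = (\<chi> t. \<Sum>I\<in>UNIV. \<Sum>J\<in>UNIV.
    a $ (I, J) * minor G I (fst t) * cnj (minor G J (snd t)))"

definition ext_dot :: "'n::{finite,linorder} ext \<Rightarrow> 'n ext \<Rightarrow> complex"
  where "ext_dot a b = (\<Sum>t\<in>UNIV. a $ t * cnj (b $ t))"

lemma sum_UNIV_prod:
  "(\<Sum>s\<in>(UNIV :: ('b::finite \<times> 'c::finite) set). f s) = (\<Sum>i\<in>UNIV. \<Sum>j\<in>UNIV. f (i, j))"
  by (simp add: sum.cartesian_product)

lemma ext_inner_lower: "ext_inner w a b = ext_dot (lower (dual_gram w) a) b"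
proof -
  have "ext_inner w a b = (\<Sum>s\<in>UNIV. \<Sum>t\<in>UNIV. a $ s * cnj (b $ t) *
      minor (dual_gram w) (fst s) (fst t) * cnj (minor (dual_gram w) (snd s) (snd t)))"
    unfolding ext_inner_def by (simp add: sum_UNIV_prod)
  also have "\<dots> = (\<Sum>t\<in>UNIV. \<Sum>s\<in>UNIV. a $ s * cnj (b $ t) *
      minor (dual_gram w) (fst s) (fst t) * cnj (minor (dual_gram w) (snd s) (snd t)))"
    by (rule sum.swap)
  also have "\<dots> = ext_dot (lower (dual_gram w) a) b"
    by (simp add: ext_dot_def lower_def sum_UNIV_prod sum_distrib_left mult_ac)
  finally show ?thesis .
qed

lemma lower_add: "lower G (a + b) = lower G a + lower G b"
  by (auto simp: lower_def vec_eq_iff algebra_simps sum.distrib)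

lemma lower_smult: "lower G (r *s a) = r *s lower G a"
  by (auto simp: lower_def vec_eq_iff sum_distrib_left mult_ac)

lemma lower_zero [simp]: "lower G 0 = 0"
  by (simp add: lower_def vec_eq_iff)

lemma lower_sum: "lower G (\<Sum>i\<in>I. f i) = (\<Sum>i\<in>I. lower G (f i))"
  by (induction I rule: infinite_finite_induct) (auto simp: lower_add)

lemma contr_add: "contr k (a + b) = contr k a + contr k b"
  by (auto simp: contr_def vec_eq_iff algebra_simps)

lemma contr_smult: "contr k (r *s a) = r *s contr k a"
  by (auto simp: contr_def vec_eq_iff)

lemma contrbar_add: "contrbar k (a + b) = contrbar k a + contrbar k b"
  by (auto simp: contrbar_def vec_eq_iff algebra_simps)

lemma contrbar_smult: "contrbar k (r *s a) = r *s contrbar k a"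
  by (auto simp: contrbar_def vec_eq_iff)

lemma contrbar_zero [simp]: "contrbar k 0 = 0"
  by (simp add: contrbar_def vec_eq_iff)

lemma contrbar_sum: "contrbar k (\<Sum>i\<in>I. f i) = (\<Sum>i\<in>I. contrbar k (f i))"
  by (induction I rule: infinite_finite_induct) (auto simp: contrbar_add)

text \<open>Expanding the minors in \<open>lower G a\<close> along column \<open>k\<close> moves the
  contraction inside, at the price of column \<open>k\<close> of \<open>G\<close> as weights. For k
  in the target index set the left side is zero by definition, and the right side is zero because a
  repeated column makes the expansion vanish.\<close>

lemma contr_lower: "contr k (lower G a) = lower G (\<Sum>i\<in>UNIV. G $ i $ k *s contr i a)"
proof -
  have "contr k (lower G a) $ (K, L) = lower G (\<Sum>i\<in>UNIV. G $ i $ k *s contr i a) $ (K, L)" for K L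
  proof -
    have "contr k (lower G a) $ (K, L) = (\<Sum>I\<in>UNIV. (\<Sum>J\<in>UNIV. a $ (I, J) * cnj (minor G J L)) *
        (if k \<in> K then 0 else insert_sign k K * minor G I (insert k K)))"
      by (simp add: contr_def lower_def sum_distrib_left sum_distrib_right mult_ac)
    also have "\<dots> = (\<Sum>I\<in>UNIV. \<Sum>i\<in>I. (\<Sum>J\<in>UNIV. a $ (I, J) * cnj (minor G J L)) *
        (insert_sign i (I - {i}) * G $ i $ k * minor G (I - {i}) K))"
      by (simp only: minor_Laplace_insert[symmetric] sum_distrib_left)
    also have "\<dots> = (\<Sum>i\<in>UNIV. \<Sum>I\<in>UNIV. if i \<in> I then 0 else
        (\<Sum>J\<in>UNIV. a $ (insert i I, J) * cnj (minor G J L)) *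
        (insert_sign i (insert i I - {i}) * G $ i $ k * minor G (insert i I - {i}) K))"
      by (rule sum_set_insert)
    also have "\<dots> = (\<Sum>i\<in>UNIV. G $ i $ k * lower G (contr i a) $ (K, L))"
    proof (rule sum.cong[OF refl], goal_cases)
      case (1 i)
      have "(if i \<in> I then 0 else (\<Sum>J\<in>UNIV. a $ (insert i I, J) * cnj (minor G J L)) *
          (insert_sign i (insert i I - {i}) * G $ i $ k * minor G (insert i I - {i}) K)) =
          G $ i $ k * (\<Sum>J\<in>UNIV. contr i a $ (I, J) * minor G I K * cnj (minor G J L))" for I
        by (cases "i \<in> I") (simp_all add: contr_def sum_distrib_left sum_distrib_right mult_ac)
      then show ?case by (simp add: lower_def sum_distrib_left)
    qed
    also have "\<dots> = lower G (\<Sum>i\<in>UNIV. G $ i $ k *s contr i a) $ (K, L)"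
      by (simp add: lower_sum lower_smult)
    finally show ?thesis .
  qed
  then show ?thesis by (simp add: vec_eq_iff)
qed

lemma contrbar_lower: "contrbar k (lower G a) = lower G (\<Sum>i\<in>UNIV. cnj (G $ i $ k) *s contrbar i a)"
proof -
  have "contrbar k (lower G a) $ (K, L) =
      lower G (\<Sum>i\<in>UNIV. cnj (G $ i $ k) *s contrbar i a) $ (K, L)" for K L
  proof -
    \<comment> \<open>The sign of \<open>contrbar\<close> refers to the outer index set before the
      exchange and to the summed one after it; a nonzero minor forces the two to have the same
      size.\<close>
    have sgn: "(-1) ^ card K * minor G I K = (-1) ^ card I * minor G I K" for I
      using minor_card[of G I K] by fastforce
    have "contrbar k (lower G a) $ (K, L) =
        (\<Sum>J\<in>UNIV. (\<Sum>I\<in>UNIV. a $ (I, J) * ((-1) ^ card K * minor G I K)) *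
          cnj (if k \<in> L then 0 else insert_sign k L * minor G J (insert k L)))"
      by (subst sum_distrib_right, subst sum.swap)
        (simp add: contrbar_def lower_def sum_distrib_left mult_ac)
    also have "\<dots> = (\<Sum>J\<in>UNIV. \<Sum>j\<in>J. (\<Sum>I\<in>UNIV. a $ (I, J) * ((-1) ^ card I * minor G I K)) *
        cnj (insert_sign j (J - {j}) * G $ j $ k * minor G (J - {j}) L))"
      by (simp only: sgn minor_Laplace_insert[symmetric] sum_distrib_left cnj_sum)
    also have "\<dots> = (\<Sum>j\<in>UNIV. \<Sum>J\<in>UNIV. if j \<in> J then 0 else
        (\<Sum>I\<in>UNIV. a $ (I, insert j J) * ((-1) ^ card I * minor G I K)) *
        cnj (insert_sign j (insert j J - {j}) * G $ j $ k * minor G (insert j J - {j}) L))"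
      by (rule sum_set_insert)
    also have "\<dots> = (\<Sum>j\<in>UNIV. \<Sum>J\<in>UNIV. \<Sum>I\<in>UNIV. cnj (G $ j $ k) *
        (contrbar j a $ (I, J) * minor G I K * cnj (minor G J L)))"
      by (auto simp: contrbar_def sum_distrib_left sum_distrib_right intro!: sum.cong)
    also have "\<dots> = (\<Sum>j\<in>UNIV. \<Sum>I\<in>UNIV. \<Sum>J\<in>UNIV. cnj (G $ j $ k) *
        (contrbar j a $ (I, J) * minor G I K * cnj (minor G J L)))"
      by (intro sum.cong refl sum.swap)
    also have "\<dots> = (\<Sum>j\<in>UNIV. cnj (G $ j $ k) * lower G (contrbar j a) $ (K, L))"
      unfolding lower_def by (simp add: sum_distrib_left)
    also have "\<dots> = lower G (\<Sum>i\<in>UNIV. cnj (G $ i $ k) *s contrbar i a) $ (K, L)"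
      by (simp add: lower_sum lower_smult)
    finally show ?thesis .
  qed
  then show ?thesis by (simp add: vec_eq_iff)
qed

lemma sum_insert_set:
  fixes f :: "'n::finite set \<Rightarrow> 'b::comm_monoid_add"
  shows "(\<Sum>I\<in>UNIV. if k \<in> I then f I else 0) = (\<Sum>I\<in>UNIV. if k \<in> I then 0 else f (insert k I))"
proof -
  have "(\<Sum>I\<in>UNIV. if k \<in> I then f I else 0) = (\<Sum>I\<in>{I. k \<in> I}. f I)"
    by (rule sum.mono_neutral_cong_right) auto
  also have "\<dots> = (\<Sum>I\<in>{I. k \<notin> I}. f (insert k I))"
    by (rule sum.reindex_bij_witness[where i = "insert k" and j = "\<lambda>I. I - {k}"])
      (auto simp: insert_absorb)
  also have "\<dots> = (\<Sum>I\<in>UNIV. if k \<in> I then 0 else f (insert k I))"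
    by (rule sum.mono_neutral_cong_left) auto
  finally show ?thesis .
qed

lemma ext_dot_alt: "ext_dot a b = (\<Sum>I\<in>UNIV. \<Sum>J\<in>UNIV. a $ (I, J) * cnj (b $ (I, J)))"
  by (simp add: ext_dot_def sum.cartesian_product case_prod_beta)

lemma ext_dot_dz: "ext_dot a (ext_wedge (dz k) v) = ext_dot (contr k a) v"
proof -
  have "ext_dot a (ext_wedge (dz k) v) = (\<Sum>I\<in>UNIV. if k \<in> I then
      \<Sum>J\<in>UNIV. a $ (I, J) * cnj (insert_sign k (I - {k}) * v $ (I - {k}, J)) else 0)"
    unfolding ext_dot_alt ext_wedge_dz_nth by (intro sum.cong) auto
  also have "\<dots> = ext_dot (contr k a) v"
    unfolding sum_insert_set ext_dot_alt by (intro sum.cong) (auto simp: contr_def intro!: sum.cong)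
  finally show ?thesis .
qed

lemma ext_dot_dzbar: "ext_dot a (ext_wedge (dzbar k) v) = ext_dot (contrbar k a) v"
proof -
  have "ext_dot a (ext_wedge (dzbar k) v) = (\<Sum>I\<in>UNIV. \<Sum>J\<in>UNIV. if k \<in> J then
      a $ (I, J) * cnj ((-1) ^ (card I + inversions {k} (J - {k})) * v $ (I, J - {k})) else 0)"
    unfolding ext_dot_alt ext_wedge_dzbar_nth by (intro sum.cong) auto
  also have "\<dots> = ext_dot (contrbar k a) v"
    unfolding sum_insert_set ext_dot_alt
    by (intro sum.cong) (auto simp: contrbar_def power_add)
  finally show ?thesis .
qed

lemma ext_dot_add_right: "ext_dot a (u + v) = ext_dot a u + ext_dot a v"
  by (simp add: ext_dot_def algebra_simps sum.distrib)

lemma ext_dot_smult_right: "ext_dot a (r *s v) = ext_dot (cnj r *s a) v"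
  by (simp add: ext_dot_def mult_ac)

lemma ext_dot_sum_right: "ext_dot a (\<Sum>i\<in>I. f i) = (\<Sum>i\<in>I. ext_dot a (f i))"
proof -
  have "ext_dot a 0 = 0" by (simp add: ext_dot_def)
  then show ?thesis
    by (induction I rule: infinite_finite_induct) (auto simp: ext_dot_add_right)
qed

lemma ext_dot_sum_left: "ext_dot (\<Sum>i\<in>I. f i) v = (\<Sum>i\<in>I. ext_dot (f i) v)"
  unfolding ext_dot_def by (subst sum.swap) (simp add: sum_distrib_right)

lemma ext_dot_eqD:
  assumes "\<And>v. ext_dot a v = ext_dot b v"
  shows "a = b"
proof -
  have "ext_dot a (axis s 1) = a $ s" for a :: "'a ext" and s
  proof -
    have "ext_dot a (axis s 1) = (\<Sum>t\<in>UNIV. if t = s then a $ t else 0)"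
      unfolding ext_dot_def by (rule sum.cong) (auto simp: axis_def)
    then show ?thesis by simp
  qed
  then have "a $ s = b $ s" for s using assms by metis
  then show ?thesis by (simp add: vec_eq_iff)
qed

text \<open>If \<open>lower G a\<close> vanishes, so do its contractions; the intertwining rules and
  the nondegeneracy of \<open>G\<close> then put every contraction of \<open>a\<close> into the
  kernel as well. Up to sign, a coefficient of positive degree is a coefficient one degree lower of
  some contraction. The induction is on the degree of the coefficient, so \<open>a\<close> may have
  mixed degree.\<close>

lemma lower_eq_0D:
  fixes G :: "'n::{finite,linorder} cmat"
  assumes G: "\<And>x :: 'n \<Rightarrow> complex. (\<And>k. (\<Sum>i\<in>UNIV. G $ i $ k * x i) = 0) \<Longrightarrow> x = (\<lambda>_. 0)"
    and "lower G a = 0"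
  shows "a = 0"
proof -
  have "a $ (I, J) = 0" if "lower G a = 0" "card I + card J = n" for n a I J
    using that
  proof (induction n arbitrary: a I J)
    case 0
    then have IJ: "I = {}" "J = {}" by auto
    have "lower G a $ ({}, {}) = (\<Sum>I\<in>UNIV. \<Sum>J\<in>UNIV. if J = {} then (if I = {} then a $ (I, J) else 0) else 0)"
      unfolding lower_def
      by (simp only: vec_lambda_beta fst_conv snd_conv minor_empty_right) (intro sum.cong refl; simp)
    then show ?case using 0 IJ by simp
  next
    case (Suc n)
    have *: "lower G (contr i a) = 0" for i
    proof -
      have "(\<Sum>i\<in>UNIV. G $ i $ k * lower G (contr i a) $ t) = 0" for k t
      proof -
        have "(\<Sum>i\<in>UNIV. G $ i $ k * lower G (contr i a) $ t) = contr k (lower G a) $ t"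
          by (simp add: contr_lower lower_sum lower_smult)
        then show ?thesis using Suc.prems by (simp add: contr_def)
      qed
      then have "lower G (contr i a) $ t = 0" for t
        using G[of "\<lambda>i. lower G (contr i a) $ t"] by metis
      then show ?thesis by (simp add: vec_eq_iff)
    qed
    have **: "lower G (contrbar i a) = 0" for i
    proof -
      \<comment> \<open>Nondegeneracy is assumed for \<open>G\<close> and not for its conjugate, so
        it is applied to the conjugated coefficients.\<close>
      have "(\<Sum>i\<in>UNIV. G $ i $ k * cnj (lower G (contrbar i a) $ t)) = 0" for k t
      proof -
        have "cnj (\<Sum>i\<in>UNIV. G $ i $ k * cnj (lower G (contrbar i a) $ t)) =
            contrbar k (lower G a) $ t"
          by (simp add: contrbar_lower lower_sum lower_smult)
        then show ?thesis
          unfolding Suc.prems(1) contrbar_zero zero_index complex_cnj_zero_iff .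
      qed
      then have "cnj (lower G (contrbar i a) $ t) = 0" for t
        using G[of "\<lambda>i. cnj (lower G (contrbar i a) $ t)"] by metis
      then show ?thesis by (simp add: vec_eq_iff)
    qed
    show ?case
    proof (cases "I = {}")
      case False
      then obtain i where i: "i \<in> I" by auto
      then have "contr i a $ (I - {i}, J) = 0"
        using Suc.prems card_Suc_Diff1[of I i] by (intro Suc.IH *) simp_all
      with i show ?thesis by (simp add: contr_def insert_absorb)
    next
      case True
      with Suc.prems obtain j where j: "j \<in> J" by fastforce
      then have "contrbar j a $ (I, J - {j}) = 0"
        using Suc.prems True card_Suc_Diff1[of J j] by (intro Suc.IH **) simp_all
      with j show ?thesis by (simp add: contrbar_def insert_absorb)
    qed
  qed
  then have "a $ (I, J) = 0" for I J using assms(2) by blast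
  then show ?thesis by (simp add: vec_eq_iff)
qed

text \<open>A vector \<open>v\<close> in the kernel of the transpose makes the Hermitian form vanish
  at \<open>v\<close>; the transpose appears because \<open>v\<close> pairs with the first
  index.\<close>

lemma herm_matrix_invertible:
  assumes "pos_def_11 w"
  shows "invertible (herm_matrix w)"
proof -
  let ?H = "herm_matrix w"
  have "v = 0" if "transpose ?H *v v = 0" for v
  proof (rule ccontr)
    assume "v \<noteq> 0"
    then have "0 < Re (\<Sum>j\<in>UNIV. \<Sum>k\<in>UNIV. ?H $ j $ k * v $ j * cnj (v $ k))"
      using assms unfolding pos_def_11_def Let_def by blast
    moreover have "(\<Sum>j\<in>UNIV. \<Sum>k\<in>UNIV. ?H $ j $ k * v $ j * cnj (v $ k)) =
        (\<Sum>k\<in>UNIV. (transpose ?H *v v) $ k * cnj (v $ k))"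
      by (subst sum.swap)
        (simp add: matrix_vector_mult_def transpose_def sum_distrib_right)
    ultimately show False unfolding that by simp
  qed
  then have "\<exists>B. B ** transpose ?H = mat 1"
    using matrix_left_invertible_ker by blast
  then show ?thesis by (simp add: left_invertible_transpose invertible_right_inverse)
qed

lemma matrix_mul_matrix_inv:
  assumes "invertible (M :: 'n::finite cmat)"
  shows "M ** matrix_inv M = mat 1"
  using assms unfolding matrix_inv_def invertible_def by (rule someI2_ex) simp

text \<open>Because of the transpose in \<open>dual_gram\<close>, the given sums are the entries of
  the inverse of \<open>herm_matrix w\<close> applied to x, and multiplying by
  \<open>herm_matrix w\<close> recovers x.\<close>

lemma dual_gram_nondegenerate:
  assumes "pos_def_11 (w :: 'n::{finite,linorder} ext)" "\<And>k. (\<Sum>i\<in>UNIV. dual_gram w $ i $ k * x i) = 0"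
  shows "x = (\<lambda>_. 0)"
proof -
  let ?H = "herm_matrix w"
  have "(matrix_inv ?H *v (\<chi> i. x i)) $ k = 0" for k
    using assms(2)[of k] by (simp only: matrix_vector_mult_def dual_gram_def transpose_def vec_lambda_beta)
  then have "matrix_inv ?H *v (\<chi> i. x i) = 0"
    unfolding vec_eq_iff zero_index by blast
  then have "?H *v (matrix_inv ?H *v (\<chi> i. x i)) = 0"
    by (simp only: matrix_vector_mult_0_right)
  then have "(\<chi> i. x i) = 0"
    unfolding matrix_vector_mul_assoc matrix_mul_matrix_inv[OF herm_matrix_invertible[OF assms(1)]]
      matrix_vector_mul_lid .
  then show ?thesis unfolding vec_eq_iff fun_eq_iff by simp
qed

lemma pos_def_11_expand:
  assumes "pos_def_11 w"
  shows "w = (\<Sum>j\<in>UNIV. \<Sum>k\<in>UNIV. w $ ({j}, {k}) *s ext_wedge (dz j) (dzbar k))"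
proof -
  have "w $ (I, J) = (\<Sum>j\<in>UNIV. \<Sum>k\<in>UNIV. w $ ({j}, {k}) *s ext_wedge (dz j) (dzbar k)) $ (I, J)" for I J
  proof (cases "w $ (I, J) = 0")
    case True
    have "(\<Sum>j\<in>UNIV. \<Sum>k\<in>UNIV. w $ ({j}, {k}) *s ext_wedge (dz j) (dzbar k)) $ (I, J) = 0"
      using True by (auto simp: dz_wedge_dzbar axis_def intro!: sum.neutral)
    with True show ?thesis by simp
  next
    case False
    then have "card I = 1" "card J = 1" using assms by (auto simp: pos_def_11_def)
    then obtain i j where IJ: "I = {i}" "J = {j}" by (meson card_1_singletonE)
    have "(\<Sum>j\<in>UNIV. \<Sum>k\<in>UNIV. w $ ({j}, {k}) *s ext_wedge (dz j) (dzbar k)) $ (I, J) =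
        (\<Sum>a\<in>UNIV. \<Sum>b\<in>UNIV. if b = j then (if a = i then w $ ({a}, {b}) else 0) else 0)"
      unfolding dz_wedge_dzbar IJ sum_component vector_smult_component
      by (intro sum.cong refl) (auto simp: axis_def)
    then show ?thesis by (simp add: IJ)
  qed
  then show ?thesis unfolding vec_eq_iff split_paired_All by blast
qed

text \<open>What remains when the factors of \<open>w\<close> are moved across the inner product one
  by one: the conjugated coefficient of \<open>w\<close> comes from sesquilinearity, and the two
  Gram entries from \<open>contr_lower\<close> and \<open>contrbar_lower\<close>. The contractions
  stand in the order opposite to the wedge factors, as for any adjoint of a composition.\<close>

definition contraction_Lambda :: "'n::{finite,linorder} ext \<Rightarrow> 'n ext \<Rightarrow> 'n ext"
  where "contraction_Lambda w a = (\<Sum>j\<in>UNIV. \<Sum>k\<in>UNIV. \<Sum>i\<in>UNIV. \<Sum>l\<in>UNIV.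
    (cnj (w $ ({j}, {k})) * cnj (dual_gram w $ l $ k) * dual_gram w $ i $ j) *s contrbar l (contr i a))"

text \<open>Gives the definite description its meaning: the adjunction computed through
  \<open>ext_dot\<close> shows existence, and the injectivity of \<open>lower\<close> shows
  uniqueness.\<close>

lemma ext_Lambda_eq:
  assumes w: "pos_def_11 w"
  shows "ext_Lambda w a = contraction_Lambda w a"
proof -
  let ?G = "dual_gram w"
  have adj: "ext_inner w a (ext_wedge w v) = ext_dot (lower ?G (contraction_Lambda w a)) v" for v
  proof -
    have "ext_wedge w v = (\<Sum>j\<in>UNIV. \<Sum>k\<in>UNIV.
        w $ ({j}, {k}) *s ext_wedge (dz j) (ext_wedge (dzbar k) v))"
      by (subst pos_def_11_expand[OF w])
        (simp add: ext_wedge_sum_left ext_wedge_smult_left ext_wedge_assoc)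
    then have "ext_inner w a (ext_wedge w v) =
        ext_dot (\<Sum>j\<in>UNIV. \<Sum>k\<in>UNIV. cnj (w $ ({j}, {k})) *s contrbar k (contr j (lower ?G a))) v"
      by (simp add: ext_inner_lower ext_dot_sum_right ext_dot_sum_left ext_dot_smult_right
          ext_dot_dz ext_dot_dzbar contr_smult contrbar_smult)
    also have "(\<Sum>j\<in>UNIV. \<Sum>k\<in>UNIV. cnj (w $ ({j}, {k})) *s contrbar k (contr j (lower ?G a))) =
        lower ?G (contraction_Lambda w a)"
    proof -
      have "cnj (w $ ({j}, {k})) *s contrbar k (contr j (lower ?G a)) =
         lower ?G (\<Sum>i\<in>UNIV. \<Sum>l\<in>UNIV. (cnj (w $ ({j}, {k})) * cnj (?G $ l $ k) * ?G $ i $ j) *s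
            contrbar l (contr i a))" for j k
        by (simp add: contr_lower contrbar_lower lower_sum lower_smult contrbar_sum contrbar_smult
            vec.scale_sum_right mult_ac)
      then show ?thesis by (simp add: contraction_Lambda_def lower_sum)
    qed
    finally show ?thesis .
  qed
  show ?thesis
    unfolding ext_Lambda_def
  proof (rule the_equality)
    show "\<forall>v. ext_inner w (contraction_Lambda w a) v = ext_inner w a (ext_wedge w v)"
      using adj by (simp add: ext_inner_lower)
  next
    fix b assume "\<forall>v. ext_inner w b v = ext_inner w a (ext_wedge w v)"
    then have "lower ?G b = lower ?G (contraction_Lambda w a)"
      using adj by (intro ext_dot_eqD) (simp add: ext_inner_lower)
    then have "lower ?G (b - contraction_Lambda w a) + lower ?G (contraction_Lambda w a) =
        0 + lower ?G (contraction_Lambda w a)"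
      by (simp flip: lower_add)
    then have "lower ?G (b - contraction_Lambda w a) = 0" by (simp only: add_right_cancel)
    then have "b - contraction_Lambda w a = 0"
      using lower_eq_0D dual_gram_nondegenerate[OF w] by blast
    then show "b = contraction_Lambda w a" by simp
  qed
qed

lemma contraction_Lambda_add:
  "contraction_Lambda w (a + b) = contraction_Lambda w a + contraction_Lambda w b"
  by (simp add: contraction_Lambda_def contr_add contrbar_add vec.scale_right_distrib sum.distrib)

lemma contraction_Lambda_smult:
  "contraction_Lambda w (r *s a) = r *s contraction_Lambda w a"
  by (simp add: contraction_Lambda_def contr_smult contrbar_smult vec.scale_sum_right mult_ac)

lemma contraction_bidegree:
  assumes "ext_bidegree p q a" "contrbar l (contr i a) $ (I, J) \<noteq> 0"
  shows "p = Suc (card I) \<and> q = Suc (card J)"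
proof -
  from assms(2) have "l \<notin> J" "i \<notin> I" "a $ (insert i I, insert l J) \<noteq> 0"
    by (auto simp: contr_def contrbar_def split: if_splits)
  with assms(1) show ?thesis unfolding ext_bidegree_def by (metis card_insert_disjoint finite)
qed

text \<open>The case distinction guards against truncated subtraction: in bidegree with p = 0 or q =
  0 there is nothing to contract, and the value is zero.\<close>

lemma ext_Lambda_bidegree:
  assumes w: "pos_def_11 w" and a: "ext_bidegree p q a"
  shows "if p = 0 \<or> q = 0 then ext_Lambda w a = 0 else ext_bidegree (p - 1) (q - 1) (ext_Lambda w a)"
proof -
  have *: "p = Suc (card I) \<and> q = Suc (card J)" if "ext_Lambda w a $ (I, J) \<noteq> 0" for I J
  proof (rule ccontr)
    assume "\<not> ?thesis"
    then have "contrbar l (contr i a) $ (I, J) = 0" for i l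
      using contraction_bidegree[OF a] by blast
    with that show False
      unfolding ext_Lambda_eq[OF w] contraction_Lambda_def by simp
  qed
  show ?thesis
  proof (cases "p = 0 \<or> q = 0")
    case True
    then have "ext_Lambda w a $ (I, J) = 0" for I J using * by force
    with True show ?thesis by (simp add: vec_eq_iff)
  next
    case False
    moreover have "ext_bidegree (p - 1) (q - 1) (ext_Lambda w a)"
      unfolding ext_bidegree_def using * by auto
    ultimately show ?thesis by simp
  qed
qed

section \<open>Calculus of \<open>C\<^sup>k\<close> maps\<close>

lemma frechet_derivative_eqI: "(f has_derivative f') (at x) \<Longrightarrow> frechet_derivative f (at x) = f'"
  by (rule frechet_derivative_at[symmetric])

lemma frechet_derivative_has: "f differentiable (at x) \<Longrightarrow> (f has_derivative frechet_derivative f (at x)) (at x)"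
  by (simp add: frechet_derivative_works)

lemma frechet_derivative_cong_open:
  assumes "open S" "x \<in> S" "\<And>y. y \<in> S \<Longrightarrow> f y = g y"
  shows "frechet_derivative f (at x) = frechet_derivative g (at x)"
proof -
  have "(f has_derivative f') (at x) \<longleftrightarrow> (g has_derivative f') (at x)" for f'
    using assms has_derivative_transform_within_open[of _ f' x UNIV S]
    by (metis (no_types))
  \<comment> \<open>The derivative is picked by a choice operator, so equivalence of the two
    predicates suffices, even where neither function is differentiable.\<close>
  then show ?thesis unfolding frechet_derivative_def by simp
qed

lemma differentiable_cong_open:
  assumes "open S" "x \<in> S" "\<And>y. y \<in> S \<Longrightarrow> f y = g y" "f differentiable (at x)"
  shows "g differentiable (at x)"
  using assms has_derivative_transform_within_open[of f _ x UNIV S g] unfolding differentiable_def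
  by metis

lemma Ck_on_cong:
  assumes "open S" "\<And>x. x \<in> S \<Longrightarrow> f x = g x"
  shows "Ck_on k S f \<longleftrightarrow> Ck_on k S g"
  using assms(2)
proof (induction k arbitrary: f g)
  case 0
  then show ?case by (simp cong: continuous_on_cong)
next
  case (Suc k)
  have "Ck_on k S (\<lambda>x. frechet_derivative f (at x) v) \<longleftrightarrow> Ck_on k S (\<lambda>x. frechet_derivative g (at x) v)" for v
    by (rule Suc.IH) (metis Suc.prems assms(1) frechet_derivative_cong_open)
  moreover have "f differentiable (at x) \<longleftrightarrow> g differentiable (at x)" if "x \<in> S" for x
    using differentiable_cong_open[OF assms(1) that] Suc.prems by metis
  ultimately show ?case by simp
qed

lemma Ck_on_SucD: "Ck_on (Suc k) S f \<Longrightarrow> Ck_on k S f"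
proof (induction k arbitrary: f)
  case 0
  then show ?case
    by (auto intro!: continuous_at_imp_continuous_on differentiable_imp_continuous_within)
qed auto

lemma Ck_on_Suc_differentiable: "Ck_on (Suc k) S f \<Longrightarrow> x \<in> S \<Longrightarrow> f differentiable (at x)"
  by simp

lemma Ck_on_frechet: "Ck_on (Suc k) S f \<Longrightarrow> Ck_on k S (\<lambda>x. frechet_derivative f (at x) v)"
  by simp

lemma Ck_on_const: "Ck_on k S (\<lambda>_. c)"
  by (induction k arbitrary: c) auto

text \<open>Lets inductions on the order work with an explicit formula for the derivative in place
  of the one picked by \<open>frechet_derivative\<close>.\<close>

lemma Ck_on_SucI:
  assumes "open S" "\<And>x. x \<in> S \<Longrightarrow> (f has_derivative f' x) (at x)" "\<And>v. Ck_on k S (\<lambda>x. f' x v)"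
  shows "Ck_on (Suc k) S f"
proof -
  have "Ck_on k S (\<lambda>x. frechet_derivative f (at x) v) \<longleftrightarrow> Ck_on k S (\<lambda>x. f' x v)" for v
    by (rule Ck_on_cong[OF assms(1)]) (simp add: frechet_derivative_eqI[OF assms(2)])
  then show ?thesis using assms(2,3) by (auto intro: differentiableI)
qed

lemma Ck_on_bounded_linear:
  assumes "open S" "bounded_linear L" "Ck_on k S f"
  shows "Ck_on k S (\<lambda>x. L (f x))"
  using assms(3)
proof (induction k arbitrary: f)
  case 0
  then show ?case using assms(2) by (simp add: bounded_linear.continuous_on)
next
  case (Suc k)
  show ?case
    by (rule Ck_on_SucI[OF assms(1), where f' = "\<lambda>x v. L (frechet_derivative f (at x) v)"])
      (use Suc in \<open>auto intro: bounded_linear.has_derivative[OF assms(2)] frechet_derivative_has\<close>)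
qed

lemma Ck_on_add:
  assumes "open S" "Ck_on k S f" "Ck_on k S g"
  shows "Ck_on k S (\<lambda>x. f x + g x)"
  using assms(2,3)
proof (induction k arbitrary: f g)
  case 0
  then show ?case by (simp add: continuous_on_add)
next
  case (Suc k)
  show ?case
  proof (rule Ck_on_SucI[OF assms(1)])
    show "((\<lambda>x. f x + g x) has_derivative
        (\<lambda>v. frechet_derivative f (at x) v + frechet_derivative g (at x) v)) (at x)" if "x \<in> S" for x
      using Suc.prems that by (intro has_derivative_add frechet_derivative_has) auto
    show "Ck_on k S (\<lambda>x. frechet_derivative f (at x) v + frechet_derivative g (at x) v)" for v
      using Suc by auto
  qed
qed

lemma Ck_on_diff:
  assumes "open S" "Ck_on k S f" "Ck_on k S g"
  shows "Ck_on k S (\<lambda>x. f x - g x)"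
  using Ck_on_add[OF assms(1,2)
      Ck_on_bounded_linear[OF assms(1) bounded_linear_minus[OF bounded_linear_ident] assms(3)]]
  by simp

lemma Ck_on_sum:
  assumes "open S" "\<And>i. i \<in> I \<Longrightarrow> Ck_on k S (f i)"
  shows "Ck_on k S (\<lambda>x. \<Sum>i\<in>I. f i x)"
  using assms(2) by (induction I rule: infinite_finite_induct) (auto simp: Ck_on_const Ck_on_add[OF assms(1)])

lemma Ck_on_bilinear:
  assumes "open S" "bounded_bilinear b" "Ck_on k S f" "Ck_on k S g"
  shows "Ck_on k S (\<lambda>x. b (f x) (g x))"
  using assms(3,4)
proof (induction k arbitrary: f g)
  case 0
  then show ?case by (simp add: bounded_bilinear.continuous_on[OF assms(2)])
next
  case (Suc k)
  show ?case
  proof (rule Ck_on_SucI[OF assms(1)])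
    show "((\<lambda>x. b (f x) (g x)) has_derivative (\<lambda>v. b (f x) (frechet_derivative g (at x) v)
        + b (frechet_derivative f (at x) v) (g x))) (at x)" if "x \<in> S" for x
      using Suc.prems that by (intro bounded_bilinear.FDERIV[OF assms(2)] frechet_derivative_has) auto
    show "Ck_on k S (\<lambda>x. b (f x) (frechet_derivative g (at x) v)
        + b (frechet_derivative f (at x) v) (g x))" for v
      using Suc.prems by (intro Ck_on_add[OF assms(1)] Suc.IH Ck_on_frechet) (auto intro: Ck_on_SucD)
  qed
qed

lemma Ck_on_mult:
  fixes f g :: "'a::real_normed_vector \<Rightarrow> 'b::real_normed_algebra"
  shows "open S \<Longrightarrow> Ck_on k S f \<Longrightarrow> Ck_on k S g \<Longrightarrow> Ck_on k S (\<lambda>x. f x * g x)"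
  by (rule Ck_on_bilinear[OF _ bounded_bilinear_mult])

lemma Ck_on_prod:
  fixes f :: "'i \<Rightarrow> 'a::real_normed_vector \<Rightarrow> 'b::real_normed_field"
  assumes "open S" "\<And>i. i \<in> I \<Longrightarrow> Ck_on k S (f i)"
  shows "Ck_on k S (\<lambda>x. \<Prod>i\<in>I. f i x)"
  using assms(2) by (induction I rule: infinite_finite_induct) (auto simp: Ck_on_const Ck_on_mult[OF assms(1)])

lemma Ck_on_inverse:
  fixes f :: "'a::real_normed_vector \<Rightarrow> 'b::real_normed_field"
  assumes "open S" "\<And>x. x \<in> S \<Longrightarrow> f x \<noteq> 0" "Ck_on k S f"
  shows "Ck_on k S (\<lambda>x. inverse (f x))"
  using assms(3)
proof (induction k)
  case 0
  then show ?case using assms(2) by (simp add: continuous_on_inverse)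
next
  case (Suc k)
  show ?case
  proof (rule Ck_on_SucI[OF assms(1)])
    \<comment> \<open>The derivative contains \<open>inverse (f x)\<close> again, but it is needed
      only to one order less, which is the induction hypothesis.\<close>
    show "((\<lambda>x. inverse (f x)) has_derivative
        (\<lambda>v. - (inverse (f x) * frechet_derivative f (at x) v * inverse (f x)))) (at x)" if "x \<in> S" for x
      using Suc.prems that assms(2) by (intro Deriv.has_derivative_inverse frechet_derivative_has) auto
    have "Ck_on k S (\<lambda>x. inverse (f x) * frechet_derivative f (at x) v * inverse (f x))" for v
      using Suc by (intro Ck_on_mult[OF assms(1)] Suc.IH Ck_on_frechet) (auto intro: Ck_on_SucD)
    then show "Ck_on k S (\<lambda>x. - (inverse (f x) * frechet_derivative f (at x) v * inverse (f x)))" for v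
      by (rule Ck_on_bounded_linear[OF assms(1) bounded_linear_minus[OF bounded_linear_ident]])
  qed
qed

section \<open>Symmetry of second derivatives\<close>

lemma has_real_derivative_along_line:
  fixes f :: "'a::real_normed_vector \<Rightarrow> real"
  assumes "f differentiable (at (a + s *\<^sub>R v))"
  shows "((\<lambda>s. f (a + s *\<^sub>R v)) has_real_derivative frechet_derivative f (at (a + s *\<^sub>R v)) v) (at s)"
proof -
  have "((\<lambda>s. a + s *\<^sub>R v) has_derivative (\<lambda>r. r *\<^sub>R v)) (at s)"
    by (auto intro!: derivative_eq_intros)
  then have "((\<lambda>s. f (a + s *\<^sub>R v)) has_derivative
      (\<lambda>r. frechet_derivative f (at (a + s *\<^sub>R v)) (r *\<^sub>R v))) (at s)"
    using has_derivative_compose frechet_derivative_has[OF assms] by blast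
  then show ?thesis
    using linear_frechet_derivative[OF assms]
    by (simp add: has_field_derivative_def linear_cmul mult.commute[of _ "frechet_derivative f (at (a + s *\<^sub>R v)) v"])
qed

text \<open>The mean value theorem is applied twice, along \<open>v\<close> to a difference in
  direction \<open>w\<close> and then along \<open>w\<close> to the derivative in direction
  \<open>v\<close>. The second difference is symmetric in \<open>v\<close> and \<open>w\<close>;
  only the intermediate point depends on the order.\<close>

lemma second_difference_mvt:
  fixes f :: "'a::real_normed_vector \<Rightarrow> real"
  assumes f: "\<And>y. y \<in> ball x d \<Longrightarrow> f differentiable (at y)"
    and fv: "\<And>y. y \<in> ball x d \<Longrightarrow> (\<lambda>y. frechet_derivative f (at y) v) differentiable (at y)"
    and h: "0 < h" "h * (norm v + norm w) < d"
  shows "\<exists>y\<in>ball x d. f (x + h *\<^sub>R v + h *\<^sub>R w) - f (x + h *\<^sub>R v) - f (x + h *\<^sub>R w) + f x =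
    h * h * frechet_derivative (\<lambda>y. frechet_derivative f (at y) v) (at y) w"
proof -
  have mem: "x + s *\<^sub>R v + t *\<^sub>R w \<in> ball x d" if "0 \<le> s" "s \<le> h" "0 \<le> t" "t \<le> h" for s t
  proof -
    have "norm (s *\<^sub>R v + t *\<^sub>R w) \<le> s * norm v + t * norm w"
      using norm_triangle_ineq[of "s *\<^sub>R v" "t *\<^sub>R w"] that by simp
    also have "\<dots> \<le> h * norm v + h * norm w"
      using that by (intro add_mono mult_right_mono) auto
    also have "\<dots> < d" using h by (simp add: algebra_simps)
    finally have "norm (s *\<^sub>R v + t *\<^sub>R w) < d" .
    moreover have "dist x (x + s *\<^sub>R v + t *\<^sub>R w) = norm (s *\<^sub>R v + t *\<^sub>R w)"
      by (metis add.assoc add_diff_cancel_left' dist_commute dist_norm)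
    ultimately show ?thesis by simp
  qed
  have swap: "x + t *\<^sub>R w + s *\<^sub>R v = x + s *\<^sub>R v + t *\<^sub>R w" for s t
    by (simp add: algebra_simps)
  define \<phi> where "\<phi> = (\<lambda>s. f (x + h *\<^sub>R w + s *\<^sub>R v) - f (x + s *\<^sub>R v))"
  have "\<exists>s. 0 < s \<and> s < h \<and> \<phi> h - \<phi> 0 = (h - 0) * (frechet_derivative f (at (x + h *\<^sub>R w + s *\<^sub>R v)) v
      - frechet_derivative f (at (x + s *\<^sub>R v)) v)"
  proof (rule MVT2[OF h(1)])
    fix s assume s: "0 \<le> s" "s \<le> h"
    show "(\<phi> has_real_derivative frechet_derivative f (at (x + h *\<^sub>R w + s *\<^sub>R v)) v
        - frechet_derivative f (at (x + s *\<^sub>R v)) v) (at s)"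
      unfolding \<phi>_def
      using mem[OF s, of h] mem[OF s, of 0] h
      by (intro DERIV_diff has_real_derivative_along_line f) (simp_all add: swap)
  qed
  then obtain s where s: "0 < s" "s < h" and s_eq: "\<phi> h - \<phi> 0 =
      h * (frechet_derivative f (at (x + s *\<^sub>R v + h *\<^sub>R w)) v - frechet_derivative f (at (x + s *\<^sub>R v)) v)"
    by (auto simp: swap)
  define \<psi> where "\<psi> = (\<lambda>t. frechet_derivative f (at (x + s *\<^sub>R v + t *\<^sub>R w)) v)"
  have "\<exists>t. 0 < t \<and> t < h \<and> \<psi> h - \<psi> 0 =
      (h - 0) * frechet_derivative (\<lambda>y. frechet_derivative f (at y) v) (at (x + s *\<^sub>R v + t *\<^sub>R w)) w"
  proof (rule MVT2[OF h(1)])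
    fix t assume t: "0 \<le> t" "t \<le> h"
    show "(\<psi> has_real_derivative frechet_derivative (\<lambda>y. frechet_derivative f (at y) v)
        (at (x + s *\<^sub>R v + t *\<^sub>R w)) w) (at t)"
      unfolding \<psi>_def using mem[of s t] s t by (intro has_real_derivative_along_line fv) auto
  qed
  then obtain t where t: "0 < t" "t < h" and t_eq: "\<psi> h - \<psi> 0 =
      h * frechet_derivative (\<lambda>y. frechet_derivative f (at y) v) (at (x + s *\<^sub>R v + t *\<^sub>R w)) w"
    by auto
  have "f (x + h *\<^sub>R v + h *\<^sub>R w) - f (x + h *\<^sub>R v) - f (x + h *\<^sub>R w) + f x = \<phi> h - \<phi> 0"
    by (simp add: \<phi>_def swap)
  also have "\<dots> = h * (\<psi> h - \<psi> 0)" by (simp add: s_eq \<psi>_def)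
  finally show ?thesis
    using mem[of s t] s t by (intro bexI[of _ "x + s *\<^sub>R v + t *\<^sub>R w"]) (auto simp: t_eq)
qed

text \<open>Both mixed derivatives, taken at suitable points near x, equal the same second
  difference divided by \<open>h * h\<close>; continuity brings both points back to x within
  \<open>e / 2\<close>.\<close>

lemma frechet_derivative_symmetric_real:
  fixes f :: "'a::real_normed_vector \<Rightarrow> real"
  assumes "open S" "x \<in> S" "Ck_on 2 S f"
  shows "frechet_derivative (\<lambda>y. frechet_derivative f (at y) v) (at x) w =
    frechet_derivative (\<lambda>y. frechet_derivative f (at y) w) (at x) v"
proof -
  define P where "P = (\<lambda>v w y. frechet_derivative (\<lambda>y. frechet_derivative f (at y) v) (at y) w)"
  have C: "Ck_on (Suc (Suc 0)) S f" using assms(3) by (simp only: numeral_2_eq_2)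
  then have diff: "\<And>y. y \<in> S \<Longrightarrow> f differentiable (at y)"
    and diff2: "\<And>y v. y \<in> S \<Longrightarrow> (\<lambda>y. frechet_derivative f (at y) v) differentiable (at y)"
    and cont: "\<And>v w. continuous_on S (P v w)"
    by (auto simp: P_def)
  have "\<bar>P v w x - P w v x\<bar> \<le> e" if "e > 0" for e
  proof -
    have near: "\<exists>d>0. \<forall>y. dist y x < d \<longrightarrow> \<bar>P v w y - P v w x\<bar> < e / 2" for v w
    proof -
      have "continuous (at x) (P v w)"
        using cont assms continuous_on_eq_continuous_at[OF assms(1)] by blast
      then show ?thesis
        using that unfolding continuous_at_eps_delta dist_real_def by (meson half_gt_zero)
    qed
    obtain d1 where d1: "d1 > 0" "\<And>y. dist y x < d1 \<Longrightarrow> \<bar>P v w y - P v w x\<bar> < e / 2"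
      using near by blast
    obtain d2 where d2: "d2 > 0" "\<And>y. dist y x < d2 \<Longrightarrow> \<bar>P w v y - P w v x\<bar> < e / 2"
      using near by blast
    obtain d3 where d3: "d3 > 0" "ball x d3 \<subseteq> S" using assms open_contains_ball by blast
    define d where "d = min d1 (min d2 d3)"
    have d: "d > 0" "ball x d \<subseteq> S" using d1 d2 d3 by (auto simp: d_def)
    \<comment> \<open>The summand 1 keeps the denominator positive when \<open>v\<close> and
      \<open>w\<close> both vanish.\<close>
    define h where "h = d / (2 * (norm v + norm w + 1))"
    have h: "h > 0" using d by (simp add: h_def add_nonneg_pos)
    have "c < 2 * (c + 1)" if "0 \<le> c" for c :: real using that by simp
    from this[of "norm v + norm w"] have "h * (norm v + norm w) < h * (2 * (norm v + norm w + 1))"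
      using h by (intro mult_strict_left_mono) (simp_all only: add_nonneg_nonneg norm_ge_zero)
    also have "\<dots> = d"
    proof -
      have "norm v + norm w + 1 > 0" by (simp add: add_nonneg_pos)
      then show ?thesis by (simp add: h_def)
    qed
    finally have hd: "h * (norm v + norm w) < d" "h * (norm w + norm v) < d"
      by (simp_all add: add.commute)
    obtain y where y: "y \<in> ball x d" "f (x + h *\<^sub>R v + h *\<^sub>R w) - f (x + h *\<^sub>R v) - f (x + h *\<^sub>R w) + f x =
        h * h * P v w y"
      using second_difference_mvt[OF diff[OF subsetD[OF d(2)]] diff2[OF subsetD[OF d(2)]] h hd(1)]
      unfolding P_def by blast
    obtain y' where y': "y' \<in> ball x d" "f (x + h *\<^sub>R w + h *\<^sub>R v) - f (x + h *\<^sub>R w) - f (x + h *\<^sub>R v) + f x =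
        h * h * P w v y'"
      using second_difference_mvt[OF diff[OF subsetD[OF d(2)]] diff2[OF subsetD[OF d(2)]] h hd(2)]
      unfolding P_def by blast
    have eq: "x + h *\<^sub>R w + h *\<^sub>R v = x + h *\<^sub>R v + h *\<^sub>R w" by (simp add: algebra_simps)
    have "h * h * P v w y = h * h * P w v y'" using y(2) y'(2) unfolding eq by linarith
    then have "P v w y = P w v y'" using h by simp
    moreover have "\<bar>P v w y - P v w x\<bar> < e / 2" "\<bar>P w v y' - P w v x\<bar> < e / 2"
      using d1(2)[of y] d2(2)[of y'] y(1) y'(1) by (auto simp: d_def dist_commute)
    ultimately show ?thesis by linarith
  qed
  then have "\<bar>P v w x - P w v x\<bar> \<le> 0" by (rule field_le_epsilon) simp
  then show ?thesis by (simp add: P_def)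
qed

lemma frechet_derivative_bounded_linear:
  assumes "bounded_linear L" "f differentiable (at x)"
  shows "frechet_derivative (\<lambda>x. L (f x)) (at x) v = L (frechet_derivative f (at x) v)"
  using frechet_derivative_eqI[OF bounded_linear.has_derivative[OF assms(1) frechet_derivative_has[OF assms(2)]]]
  by simp

lemma frechet_derivative_symmetric:
  fixes f :: "'a::real_normed_vector \<Rightarrow> 'b::euclidean_space"
  assumes "open S" "x \<in> S" "Ck_on 2 S f"
  shows "frechet_derivative (\<lambda>y. frechet_derivative f (at y) v) (at x) w =
    frechet_derivative (\<lambda>y. frechet_derivative f (at y) w) (at x) v"
proof (rule euclidean_eqI)
  fix b :: 'b
  have C: "Ck_on (Suc (Suc 0)) S f" using assms(3) by (simp only: numeral_2_eq_2)
  have eq: "frechet_derivative (\<lambda>y. frechet_derivative (\<lambda>y. f y \<bullet> b) (at y) v) (at x) w =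
      frechet_derivative (\<lambda>y. frechet_derivative f (at y) v) (at x) w \<bullet> b" for v w
  proof -
    have "frechet_derivative (\<lambda>y. frechet_derivative (\<lambda>y. f y \<bullet> b) (at y) v) (at x) =
        frechet_derivative (\<lambda>y. frechet_derivative f (at y) v \<bullet> b) (at x)"
      by (rule frechet_derivative_cong_open[OF assms(1,2)])
        (use C in \<open>auto intro: frechet_derivative_bounded_linear[OF bounded_linear_inner_left]\<close>)
    then show ?thesis
      using C assms(2) by (simp add: frechet_derivative_bounded_linear[OF bounded_linear_inner_left])
  qed
  have "Ck_on 2 S (\<lambda>y. f y \<bullet> b)"
    by (rule Ck_on_bounded_linear[OF assms(1) bounded_linear_inner_left assms(3)])
  from frechet_derivative_symmetric_real[OF assms(1,2) this, of v w]
  show "frechet_derivative (\<lambda>y. frechet_derivative f (at y) v) (at x) w \<bullet> b =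
    frechet_derivative (\<lambda>y. frechet_derivative f (at y) w) (at x) v \<bullet> b"
    unfolding eq .
qed

section \<open>First-order operators with constant one-form symbols\<close>

text \<open>Both \<open>\<partial>\<close> and its conjugate are of this shape, so the Leibniz and commutation rules are only
  needed once.\<close>
definition symbol_d :: "((complex, 'n) vec \<Rightarrow> 'n::{finite,linorder} ext) \<Rightarrow> ((complex, 'n) vec \<Rightarrow> 'n ext) \<Rightarrow>
    (complex, 'n) vec \<Rightarrow> 'n ext"
  where "symbol_d \<sigma> F z = (\<Sum>b\<in>Basis. ext_wedge (\<sigma> b) (frechet_derivative F (at z) b))"

text \<open>The value of \<open>symbol_d\<close> on a real function regarded as a zero-form, see
  \<open>symbol_d_scalar\<close>. Keeping the function real-valued gives direct access to the chain
  and product rules.\<close>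

definition symbol_grad :: "((complex, 'n) vec \<Rightarrow> 'n::{finite,linorder} ext) \<Rightarrow> ((complex, 'n) vec \<Rightarrow> real) \<Rightarrow>
    (complex, 'n) vec \<Rightarrow> 'n ext"
  where "symbol_grad \<sigma> e z = (\<Sum>b\<in>Basis. complex_of_real (frechet_derivative e (at z) b) *s \<sigma> b)"

text \<open>Only the total degree is fixed, so that the same rules cover both operators and any
  mixture of the two.\<close>

definition one_form_symbol :: "((complex, 'n) vec \<Rightarrow> 'n::{finite,linorder} ext) \<Rightarrow> bool"
  where "one_form_symbol \<sigma> \<longleftrightarrow> (\<forall>v. ext_degree 1 (\<sigma> v))"

lemma ext_degree_symbol_grad: "one_form_symbol \<sigma> \<Longrightarrow> ext_degree 1 (symbol_grad \<sigma> e z)"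
  by (simp add: symbol_grad_def one_form_symbol_def ext_degree_sum ext_degree_smult)

lemma symbol_d_cong:
  assumes "open S" "z \<in> S" "\<And>y. y \<in> S \<Longrightarrow> F y = G y"
  shows "symbol_d \<sigma> F z = symbol_d \<sigma> G z"
  using frechet_derivative_cong_open[of S z F G] assms by (simp add: symbol_d_def)

lemma symbol_d_diff:
  assumes "F differentiable (at z)" "G differentiable (at z)"
  shows "symbol_d \<sigma> (\<lambda>y. F y - G y) z = symbol_d \<sigma> F z - symbol_d \<sigma> G z"
  using frechet_derivative_eqI[OF has_derivative_diff[OF assms[THEN frechet_derivative_has]]]
  by (simp add: symbol_d_def ext_wedge_diff_right sum_subtractf)

lemma bounded_bilinear_real_smult: "bounded_bilinear (\<lambda>r (v :: complex ^ 'm). complex_of_real r *s v)"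
proof -
  have "(\<lambda>r (v :: complex ^ 'm). complex_of_real r *s v) = scaleR"
    by (intro ext) (rule scaleR_eq_smult[symmetric])
  then show ?thesis by (simp only: bounded_bilinear_scaleR)
qed

lemma bounded_linear_smult: "bounded_linear (\<lambda>v :: complex ^ 'm::finite. c *s v)"
  unfolding linear_conv_bounded_linear[symmetric]
  by (intro linearI) (auto simp: vec_eq_iff algebra_simps)

lemma symbol_d_fmult:
  assumes "g differentiable (at z)" "F differentiable (at z)"
  shows "symbol_d \<sigma> (\<lambda>y. complex_of_real (g y) *s F y) z =
    ext_wedge (symbol_grad \<sigma> g z) (F z) + complex_of_real (g z) *s symbol_d \<sigma> F z"
  using frechet_derivative_eqI[OF bounded_bilinear.FDERIV[OF bounded_bilinear_real_smult
        assms[THEN frechet_derivative_has]]]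
  by (simp add: symbol_d_def symbol_grad_def ext_wedge_add_right ext_wedge_smult_right sum.distrib
      ext_wedge_sum_left ext_wedge_smult_left vec.scale_sum_right add.commute)

lemma symbol_d_smult:
  assumes "F differentiable (at z)"
  shows "symbol_d \<sigma> (\<lambda>y. c *s F y) z = c *s symbol_d \<sigma> F z"
  by (simp add: symbol_d_def frechet_derivative_bounded_linear[OF bounded_linear_smult assms]
      ext_wedge_smult_right vec.scale_sum_right)

text \<open>The minus sign arises from moving each symbol past the one-form
  \<open>a z\<close>.\<close>

lemma symbol_d_one_form_wedge:
  assumes "one_form_symbol \<sigma>" "ext_degree 1 (a z)" "a differentiable (at z)" "F differentiable (at z)"
  shows "symbol_d \<sigma> (\<lambda>y. ext_wedge (a y) (F y)) z =
    ext_wedge (symbol_d \<sigma> a z) (F z) - ext_wedge (a z) (symbol_d \<sigma> F z)"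
proof -
  have "ext_wedge (\<sigma> b) (ext_wedge (a z) v) = - ext_wedge (a z) (ext_wedge (\<sigma> b) v)" for b v
    using assms(1,2) by (intro one_form_anticommute) (auto simp: one_form_symbol_def)
  then show ?thesis
    using frechet_derivative_eqI[OF bounded_bilinear.FDERIV[OF bounded_bilinear_ext_wedge
          assms(3,4)[THEN frechet_derivative_has]]]
    by (simp add: symbol_d_def ext_wedge_add_right sum.distrib sum_subtractf
        ext_wedge_sum_left ext_wedge_sum_right ext_wedge_assoc)
qed

lemma Ck_on_symbol_d:
  assumes "open S" "Ck_on (Suc k) S F"
  shows "Ck_on k S (symbol_d \<sigma> F)"
proof -
  have "Ck_on k S (\<lambda>z. \<Sum>b\<in>Basis. ext_wedge (\<sigma> b) (frechet_derivative F (at z) b))"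
    by (intro Ck_on_sum Ck_on_bilinear[OF _ bounded_bilinear_ext_wedge] Ck_on_const Ck_on_frechet assms)
  then show ?thesis by (simp add: symbol_d_def[abs_def])
qed

lemma Ck_on_symbol_grad:
  assumes "open S" "Ck_on (Suc k) S e"
  shows "Ck_on k S (symbol_grad \<sigma> e)"
proof -
  have "Ck_on k S (\<lambda>z. \<Sum>b\<in>Basis. complex_of_real (frechet_derivative e (at z) b) *s \<sigma> b)"
    by (intro Ck_on_sum Ck_on_bilinear[OF _ bounded_bilinear_real_smult] Ck_on_const Ck_on_frechet assms)
  then show ?thesis by (simp add: symbol_grad_def[abs_def])
qed

lemma symbol_d_anticommute:
  assumes "one_form_symbol \<sigma>" "one_form_symbol \<tau>" "open S" "z \<in> S" "Ck_on 2 S F"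
  shows "symbol_d \<sigma> (symbol_d \<tau> F) z = - symbol_d \<tau> (symbol_d \<sigma> F) z"
proof -
  let ?F2 = "\<lambda>b c. frechet_derivative (\<lambda>y. frechet_derivative F (at y) c) (at z) b"
  have C: "Ck_on (Suc (Suc 0)) S F" using assms(5) by (simp only: numeral_2_eq_2)
  have expand: "symbol_d \<sigma> (symbol_d \<tau> F) z =
      (\<Sum>b\<in>Basis. \<Sum>c\<in>Basis. ext_wedge (\<sigma> b) (ext_wedge (\<tau> c) (?F2 b c)))" for \<sigma> \<tau>
  proof -
    have "(symbol_d \<tau> F has_derivative (\<lambda>b. \<Sum>c\<in>Basis. ext_wedge (\<tau> c) (?F2 b c))) (at z)"
      unfolding symbol_d_def[abs_def]
      using C assms(4) by (intro has_derivative_sum frechet_derivative_has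
          bounded_linear.has_derivative[OF bounded_bilinear.bounded_linear_right[OF bounded_bilinear_ext_wedge]]) auto
    from frechet_derivative_eqI[OF this] show ?thesis
      by (simp add: symbol_d_def[of \<sigma>] ext_wedge_sum_right)
  qed
  have "symbol_d \<sigma> (symbol_d \<tau> F) z =
      (\<Sum>c\<in>Basis. \<Sum>b\<in>Basis. ext_wedge (\<sigma> b) (ext_wedge (\<tau> c) (?F2 b c)))"
    unfolding expand by (rule sum.swap)
  also have "\<dots> = (\<Sum>c\<in>Basis. \<Sum>b\<in>Basis. - ext_wedge (\<tau> c) (ext_wedge (\<sigma> b) (?F2 c b)))"
    using assms(1,2) frechet_derivative_symmetric[OF assms(3-5)]
    by (intro sum.cong refl) (metis one_form_anticommute one_form_symbol_def)
  also have "\<dots> = - symbol_d \<tau> (symbol_d \<sigma> F) z"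
    unfolding expand by (simp add: sum_negf)
  finally show ?thesis .
qed

lemma bounded_linear_scalar_form:
  "bounded_linear (\<lambda>r. axis ({}, {}) (complex_of_real r) :: 'n::{finite,linorder} ext)"
  unfolding linear_conv_bounded_linear[symmetric]
  by (intro linearI) (auto simp: scaleR_eq_smult vec_eq_iff axis_def)

lemma symbol_d_scalar:
  assumes "e differentiable (at z)"
  shows "symbol_d \<sigma> (\<lambda>y. axis ({}, {}) (complex_of_real (e y))) z = symbol_grad \<sigma> e z"
  by (simp add: symbol_d_def symbol_grad_def
      frechet_derivative_bounded_linear[OF bounded_linear_scalar_form assms])

text \<open>Regarding \<open>e\<close> as a zero-form turns its gradients into values of
  \<open>symbol_d\<close>, to which the rule for forms applies.\<close>

lemma symbol_d_grad_anticommute: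
  assumes "one_form_symbol \<sigma>" "one_form_symbol \<tau>" "open S" "z \<in> S" "Ck_on 2 S e"
  shows "symbol_d \<sigma> (symbol_grad \<tau> e) z = - symbol_d \<tau> (symbol_grad \<sigma> e) z"
proof -
  let ?E = "\<lambda>y. axis ({}, {}) (complex_of_real (e y))"
  have C: "Ck_on (Suc (Suc 0)) S e" using assms(5) by (simp only: numeral_2_eq_2)
  have *: "symbol_d \<sigma> (symbol_grad \<tau> e) z = symbol_d \<sigma> (symbol_d \<tau> ?E) z" for \<sigma> \<tau>
    by (rule symbol_d_cong[OF assms(3,4)]) (use C in \<open>auto simp: symbol_d_scalar\<close>)
  show ?thesis
    unfolding * by (rule symbol_d_anticommute[OF assms(1-4)
          Ck_on_bounded_linear[OF assms(3) bounded_linear_scalar_form assms(5)]])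
qed

lemma symbol_grad_compose:
  assumes "e differentiable (at z)" "(g has_real_derivative g') (at (e z))"
  shows "symbol_grad \<sigma> (\<lambda>y. g (e y)) z = complex_of_real g' *s symbol_grad \<sigma> e z"
proof -
  have "((\<lambda>y. g (e y)) has_derivative (\<lambda>v. g' * frechet_derivative e (at z) v)) (at z)"
    using has_derivative_compose[OF frechet_derivative_has[OF assms(1)]
        assms(2)[unfolded has_field_derivative_def]] .
  from frechet_derivative_eqI[OF this] show ?thesis
    by (simp add: symbol_grad_def vec.scale_sum_right)
qed

text \<open>A coefficient outside bidegree (p, q) is zero on all of the open set, hence so is its
  derivative; the symbol then adds its own bidegree.\<close>

lemma ext_bidegree_symbol_d:
  assumes "\<And>v. ext_bidegree r s (\<sigma> v)" "open S" "z \<in> S" "F differentiable (at z)"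
    "\<And>y. y \<in> S \<Longrightarrow> ext_bidegree p q (F y)"
  shows "ext_bidegree (r + p) (s + q) (symbol_d \<sigma> F z)"
proof -
  have "ext_bidegree p q (frechet_derivative F (at z) v)" for v
    unfolding ext_bidegree_def
  proof (intro allI impI, rule ccontr)
    fix I J assume *: "frechet_derivative F (at z) v $ (I, J) \<noteq> 0" "\<not> (card I = p \<and> card J = q)"
    have "frechet_derivative F (at z) v $ (I, J) = frechet_derivative (\<lambda>y. F y $ (I, J)) (at z) v"
      by (rule frechet_derivative_bounded_linear[OF bounded_linear_vec_nth assms(4), symmetric])
    also have "frechet_derivative (\<lambda>y. F y $ (I, J)) (at z) = frechet_derivative (\<lambda>y. 0) (at z)"
      by (rule frechet_derivative_cong_open[OF assms(2,3)]) (use *(2) assms(5) in \<open>auto simp: ext_bidegree_def\<close>)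
    finally show False using *(1) by simp
  qed
  then show ?thesis
    unfolding symbol_d_def by (intro ext_bidegree_sum ext_bidegree_wedge assms(1))
qed

section \<open>Differentiating a twisted first-order expression\<close>

lemma Ck_on_twist:
  assumes "open S" "Ck_on (Suc k) S U" "Ck_on (Suc k) S e" "\<And>y. y \<in> S \<Longrightarrow> e y \<noteq> 0"
  shows "Ck_on k S (\<lambda>y. symbol_d \<tau> U y - complex_of_real (1 / e y) *s
    ext_wedge (symbol_grad \<tau> e y) (q *s U y))"
proof -
  have r: "Ck_on k S (\<lambda>y. 1 / e y)"
    using Ck_on_inverse[OF assms(1,4) Ck_on_SucD[OF assms(3)]] by (simp add: inverse_eq_divide)
  have qU: "Ck_on k S (\<lambda>y. q *s U y)"
    by (rule Ck_on_bounded_linear[OF assms(1) bounded_linear_smult Ck_on_SucD[OF assms(2)]])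
  have W: "Ck_on k S (\<lambda>y. ext_wedge (symbol_grad \<tau> e y) (q *s U y))"
    by (rule Ck_on_bilinear[OF assms(1) bounded_bilinear_ext_wedge Ck_on_symbol_grad[OF assms(1,3)] qU])
  show ?thesis
    by (rule Ck_on_diff[OF assms(1) Ck_on_symbol_d[OF assms(1,2)]
          Ck_on_bilinear[OF assms(1) bounded_bilinear_real_smult r W]])
qed

text \<open>Stated for two arbitrary symbols so that it serves both orders of composition. The term
  with the square of \<open>e z\<close> in the denominator comes from the derivative of
  \<open>1 / e\<close>, whose sign cancels the minus of the twist.\<close>

lemma symbol_d_twist:
  assumes \<sigma>: "one_form_symbol \<sigma>" and \<tau>: "one_form_symbol \<tau>"
    and S: "open S" "z \<in> S" and U: "Ck_on 2 S U" and e: "Ck_on 2 S e" "e z \<noteq> 0"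
  shows "symbol_d \<sigma> (\<lambda>y. symbol_d \<tau> U y - complex_of_real (1 / e y) *s
        ext_wedge (symbol_grad \<tau> e y) (q *s U y)) z =
    symbol_d \<sigma> (symbol_d \<tau> U) z
    + (q / (complex_of_real (e z))\<^sup>2) *s ext_wedge (symbol_grad \<sigma> e z) (ext_wedge (symbol_grad \<tau> e z) (U z))
    - (q / complex_of_real (e z)) *s (ext_wedge (symbol_d \<sigma> (symbol_grad \<tau> e) z) (U z)
        - ext_wedge (symbol_grad \<tau> e z) (symbol_d \<sigma> U z))"
proof -
  have C: "Ck_on (Suc (Suc 0)) S U" "Ck_on (Suc (Suc 0)) S e" using U e by (simp_all only: numeral_2_eq_2)
  have U1: "U differentiable (at z)" and e1: "e differentiable (at z)"
    using C S by auto
  have dU: "symbol_d \<tau> U differentiable (at z)" and de: "symbol_grad \<tau> e differentiable (at z)"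
    using Ck_on_Suc_differentiable[OF Ck_on_symbol_d[OF S(1) C(1)] S(2)]
      Ck_on_Suc_differentiable[OF Ck_on_symbol_grad[OF S(1) C(2)] S(2)] by auto
  have ie: "(\<lambda>y. 1 / e y) differentiable (at z)" and
    gie: "symbol_grad \<sigma> (\<lambda>y. 1 / e y) z = complex_of_real (- (1 / (e z)\<^sup>2)) *s symbol_grad \<sigma> e z"
  proof -
    have *: "((\<lambda>x. 1 / x) has_real_derivative - (1 / (e z)\<^sup>2)) (at (e z))"
      using e(2) by (auto intro!: derivative_eq_intros simp: power2_eq_square)
    show "symbol_grad \<sigma> (\<lambda>y. 1 / e y) z = complex_of_real (- (1 / (e z)\<^sup>2)) *s symbol_grad \<sigma> e z"
      by (rule symbol_grad_compose[OF e1 *])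
    show "(\<lambda>y. 1 / e y) differentiable (at z)"
      using differentiable_divide[OF differentiable_const e1 e(2)] .
  qed
  have qU: "(\<lambda>y. q *s U y) differentiable (at z)"
    using bounded_linear.has_derivative[OF bounded_linear_smult frechet_derivative_has[OF U1]]
    by (rule differentiableI)
  have W: "(\<lambda>y. ext_wedge (symbol_grad \<tau> e y) (q *s U y)) differentiable (at z)"
    using bounded_bilinear.FDERIV[OF bounded_bilinear_ext_wedge frechet_derivative_has[OF de]
        frechet_derivative_has[OF qU]]
    by (rule differentiableI)
  have eW: "(\<lambda>y. complex_of_real (1 / e y) *s ext_wedge (symbol_grad \<tau> e y) (q *s U y)) differentiable (at z)"
    using bounded_bilinear.FDERIV[OF bounded_bilinear_real_smult frechet_derivative_has[OF ie]
        frechet_derivative_has[OF W]]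
    by (rule differentiableI)
  show ?thesis
    unfolding symbol_d_diff[OF dU eW] symbol_d_fmult[OF ie W]
      symbol_d_one_form_wedge[OF \<sigma> ext_degree_symbol_grad[OF \<tau>] de qU] symbol_d_smult[OF U1] gie
    by (auto simp: vec_eq_iff ext_wedge_smult_left ext_wedge_smult_right ext_wedge_minus_left field_simps)
qed

section \<open>The Dolbeault operators in a chart\<close>

lemma sum_Basis_complex_vec:
  "(\<Sum>b\<in>(Basis :: (complex ^ 'n) set). f b) = (\<Sum>j\<in>UNIV. f (axis j 1) + f (axis j \<i>))"
proof -
  have Basis: "(Basis :: (complex ^ 'n) set) = (\<lambda>(j, u). axis j u) ` (UNIV \<times> {1, \<i>})"
    by (auto simp: Basis_vec_def Basis_complex_def)
  have inj: "inj_on (\<lambda>(j, u). axis j u :: complex ^ 'n) (UNIV \<times> {1, \<i>})"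
    by (auto simp: inj_on_def axis_eq_axis)
  have "(\<Sum>b\<in>(Basis :: (complex ^ 'n) set). f b) = (\<Sum>(j, u)\<in>UNIV \<times> {1, \<i>}. f (axis j u))"
    unfolding Basis by (subst sum.reindex[OF inj]) (simp add: case_prod_beta o_def)
  also have "\<dots> = (\<Sum>j\<in>UNIV. \<Sum>u\<in>{1, \<i>}. f (axis j u))"
    by (simp only: sum.cartesian_product)
  also have "\<dots> = (\<Sum>j\<in>UNIV. f (axis j 1) + f (axis j \<i>))"
    by (intro sum.cong refl) (simp add: complex_eq_iff)
  finally show ?thesis .
qed

text \<open>The real basis directions \<open>axis j 1\<close> and \<open>axis j \<i>\<close> receive
  \<open>dz j / 2\<close> and \<open>- \<i> dz j / 2\<close>, the weights of the Wirtinger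
  derivative; the conjugate on \<open>v $ j\<close> produces that sign, and its absence in
  \<open>delbar_symbol\<close> the opposite one.\<close>

definition del_symbol :: "(complex, 'n) vec \<Rightarrow> 'n::{finite,linorder} ext"
  where "del_symbol v = (1/2) *s (\<Sum>j\<in>UNIV. cnj (v $ j) *s dz j)"

definition delbar_symbol :: "(complex, 'n) vec \<Rightarrow> 'n::{finite,linorder} ext"
  where "delbar_symbol v = (1/2) *s (\<Sum>j\<in>UNIV. (v $ j) *s dzbar j)"

lemma del_symbol_axis: "del_symbol (axis j r) = (cnj r / 2) *s dz j"
proof -
  have "(\<Sum>i\<in>UNIV. cnj (axis j r $ i) *s dz i) = (\<Sum>i\<in>UNIV. if i = j then cnj r *s dz i else 0)"
    by (intro sum.cong refl) (auto simp: axis_def)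
  then show ?thesis by (simp add: del_symbol_def)
qed

lemma delbar_symbol_axis: "delbar_symbol (axis j r) = (r / 2) *s dzbar j"
proof -
  have "(\<Sum>i\<in>UNIV. (axis j r $ i) *s dzbar i) = (\<Sum>i\<in>UNIV. if i = j then r *s dzbar i else 0)"
    by (intro sum.cong refl) (auto simp: axis_def)
  then show ?thesis by (simp add: delbar_symbol_def)
qed

lemma ext_bidegree_del_symbol: "ext_bidegree 1 0 (del_symbol v)"
  unfolding del_symbol_def by (intro ext_bidegree_smult ext_bidegree_sum ext_bidegree_dz)

lemma ext_bidegree_delbar_symbol: "ext_bidegree 0 1 (delbar_symbol v)"
  unfolding delbar_symbol_def by (intro ext_bidegree_smult ext_bidegree_sum ext_bidegree_dzbar)

lemma one_form_symbol_del: "one_form_symbol del_symbol" "one_form_symbol delbar_symbol"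
  using ext_bidegree_degree[OF ext_bidegree_del_symbol] ext_bidegree_degree[OF ext_bidegree_delbar_symbol]
  by (auto simp: one_form_symbol_def)

lemma ext_cnj_delbar_symbol: "ext_cnj (delbar_symbol v) = del_symbol v"
  by (simp add: delbar_symbol_def del_symbol_def ext_cnj_smult ext_cnj_sum ext_cnj_dzbar)

lemma del_eq: "del u c x = symbol_d del_symbol (u c \<circ> param c) (coord c x)"
  unfolding del_def symbol_d_def sum_Basis_complex_vec
  by (intro sum.cong refl) (simp add: wirt_def del_symbol_axis vec_eq_iff
      ext_wedge_smult_left ext_wedge_smult_right ext_wedge_diff_right ext_wedge_minus_left algebra_simps)

lemma delbar_eq: "delbar u c x = symbol_d delbar_symbol (u c \<circ> param c) (coord c x)"
  unfolding delbar_def symbol_d_def sum_Basis_complex_vec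
  by (intro sum.cong refl) (simp add: wirtbar_def delbar_symbol_axis vec_eq_iff
      ext_wedge_smult_left ext_wedge_smult_right ext_wedge_add_right algebra_simps)

lemma symbol_d_cnj:
  assumes "F differentiable (at z)"
  shows "ext_cnj (symbol_d delbar_symbol (\<lambda>y. ext_cnj (F y)) z) = symbol_d del_symbol F z"
  by (simp add: symbol_d_def ext_cnj_sum ext_cnj_wedge ext_cnj_delbar_symbol
      frechet_derivative_bounded_linear[OF bounded_linear_ext_cnj assms])

lemma symbol_grad_cnj: "ext_cnj (symbol_grad delbar_symbol e z) = symbol_grad del_symbol e z"
  by (simp add: symbol_grad_def ext_cnj_sum ext_cnj_smult ext_cnj_delbar_symbol)

section \<open>Smoothness of the adjoint\<close>

lemma bounded_linear_contr: "bounded_linear (contr k)"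
  unfolding linear_conv_bounded_linear[symmetric]
  by (intro linearI) (auto simp: contr_add contr_smult scaleR_eq_smult)

lemma bounded_linear_contrbar: "bounded_linear (contrbar k)"
  unfolding linear_conv_bounded_linear[symmetric]
  by (intro linearI) (auto simp: contrbar_add contrbar_smult scaleR_eq_smult)

lemma bounded_bilinear_smult: "bounded_bilinear (\<lambda>r (v :: complex ^ 'm::finite). r *s v)"
  unfolding bilinear_conv_bounded_bilinear[symmetric] bilinear_def
  by (auto intro!: linearI simp: vec_eq_iff algebra_simps)

lemma Ck_on_det:
  fixes H :: "'a::real_normed_vector \<Rightarrow> complex ^ 'n ^ 'n"
  assumes "open S" "\<And>i j. Ck_on k S (\<lambda>y. H y $ i $ j)"
  shows "Ck_on k S (\<lambda>y. det (H y))"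
  unfolding det_def
  by (intro Ck_on_sum Ck_on_mult Ck_on_const Ck_on_prod assms)

text \<open>Column l of the inverse solves a linear system with right side \<open>axis l 1\<close>.
  Cramer's rule writes its entries as quotients of determinants, from which differentiability in the
  matrix entries can be read off.\<close>

lemma matrix_inv_cramer:
  fixes H :: "complex ^ 'n ^ 'n"
  assumes "invertible H"
  shows "matrix_inv H $ k $ l = det (\<chi> i j. if j = k then axis l 1 $ i else H $ i $ j) * inverse (det H)"
proof -
  have "det H \<noteq> 0" using assms by (simp add: invertible_det_nz)
  have "(H *v (\<chi> j. matrix_inv H $ j $ l)) $ i = (H ** matrix_inv H) $ i $ l" for i
    by (simp add: matrix_vector_mult_def matrix_matrix_mult_def)
  then have "H *v (\<chi> j. matrix_inv H $ j $ l) = axis l 1"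
    unfolding matrix_mul_matrix_inv[OF assms] by (auto simp: vec_eq_iff mat_def axis_def)
  then have "(\<chi> j. matrix_inv H $ j $ l) =
      (\<chi> k. det (\<chi> i j. if j = k then axis l 1 $ i else H $ i $ j) / det H)"
    by (simp only: cramer[OF \<open>det H \<noteq> 0\<close>])
  then have "(\<chi> j. matrix_inv H $ j $ l) $ k =
      (\<chi> k. det (\<chi> i j. if j = k then axis l 1 $ i else H $ i $ j) / det H) $ k"
    by (rule arg_cong)
  then show ?thesis by (simp only: vec_lambda_beta divide_inverse)
qed

lemma Ck_on_dual_gram:
  assumes S: "open S" and W: "Ck_on k S W" and pos: "\<And>y. y \<in> S \<Longrightarrow> pos_def_11 (W y)"
  shows "Ck_on k S (\<lambda>y. dual_gram (W y) $ l $ m)"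
proof -
  have H: "Ck_on k S (\<lambda>y. herm_matrix (W y) $ i $ j)" for i j
    unfolding herm_matrix_def vec_lambda_beta
    by (intro Ck_on_mult[OF S] Ck_on_const Ck_on_bounded_linear[OF S bounded_linear_vec_nth W])
  have A: "Ck_on k S (\<lambda>y. (\<chi> i j. if j = m then axis l 1 $ i else herm_matrix (W y) $ i $ j) $ i $ j)" for i j
    using H by (cases "j = m") (auto simp: Ck_on_const)
  have "Ck_on k S (\<lambda>y. det (\<chi> i j. if j = m then axis l 1 $ i else herm_matrix (W y) $ i $ j)
      * inverse (det (herm_matrix (W y))))"
    using herm_matrix_invertible[OF pos]
    by (intro Ck_on_mult[OF S] Ck_on_inverse[OF S] Ck_on_det[OF S] H A) (auto simp: invertible_det_nz)
  moreover have "dual_gram (W y) $ l $ m =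
      det (\<chi> i j. if j = m then axis l 1 $ i else herm_matrix (W y) $ i $ j)
      * inverse (det (herm_matrix (W y)))" if "y \<in> S" for y
    using matrix_inv_cramer[OF herm_matrix_invertible[OF pos[OF that]]]
    by (simp add: dual_gram_def transpose_def)
  ultimately show ?thesis using Ck_on_cong[OF S] by (metis (no_types, lifting))
qed

lemma Ck_on_ext_Lambda:
  assumes S: "open S" and W: "Ck_on k S W" and pos: "\<And>y. y \<in> S \<Longrightarrow> pos_def_11 (W y)"
    and U: "Ck_on k S U"
  shows "Ck_on k S (\<lambda>y. ext_Lambda (W y) (U y))"
proof -
  have "Ck_on k S (\<lambda>y. contraction_Lambda (W y) (U y))"
    unfolding contraction_Lambda_def
    by (intro Ck_on_sum[OF S] Ck_on_bilinear[OF S bounded_bilinear_smult] Ck_on_mult[OF S]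
        Ck_on_dual_gram[OF S W pos] Ck_on_bounded_linear[OF S bounded_linear_cnj]
        Ck_on_bounded_linear[OF S bounded_linear_vec_nth W]
        Ck_on_bounded_linear[OF S bounded_linear_contrbar]
        Ck_on_bounded_linear[OF S bounded_linear_contr U])
  moreover have "Ck_on k S (\<lambda>y. contraction_Lambda (W y) (U y)) \<longleftrightarrow> Ck_on k S (\<lambda>y. ext_Lambda (W y) (U y))"
    by (rule Ck_on_cong[OF S]) (simp add: ext_Lambda_eq pos)
  ultimately show ?thesis by simp
qed

section \<open>The twisted operators in a chart\<close>

text \<open>The setting of one chart. The identities contain at most second derivatives, hence order
  2, and nonvanishing covers both signs of \<open>\<eta>\<close> at once.\<close>

locale dolbeault_chart =
  fixes c :: "('a, 'n::{finite,linorder}) chart" and \<eta> :: "'a \<Rightarrow> real"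
  assumes inj: "inj_on (coord c) (dom_of c)"
    and open_img: "open (img_of c)"
    and C2_eta: "Ck_on 2 (img_of c) (\<eta> \<circ> param c)"
    and eta_nz: "x \<in> dom_of c \<Longrightarrow> \<eta> x \<noteq> 0"
begin

definition bidegree_on :: "nat \<Rightarrow> nat \<Rightarrow> ('a, 'n) form \<Rightarrow> bool"
  where "bidegree_on p q u \<longleftrightarrow> (\<forall>x\<in>dom_of c. ext_bidegree p q (u c x))"

definition C2_form :: "('a, 'n) form \<Rightarrow> bool"
  where "C2_form u \<longleftrightarrow> Ck_on 2 (img_of c) (u c \<circ> param c)"

lemma param_coord [simp]: "x \<in> dom_of c \<Longrightarrow> param c (coord c x) = x"
  using inj by (rule inv_into_f_f)

lemma param_mem: "y \<in> img_of c \<Longrightarrow> param c y \<in> dom_of c"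
  by (rule inv_into_into)

lemma coord_param [simp]: "y \<in> img_of c \<Longrightarrow> coord c (param c y) = y"
  by (rule f_inv_into_f)

lemma eta_param_nz: "y \<in> img_of c \<Longrightarrow> (\<eta> \<circ> param c) y \<noteq> 0"
  using eta_nz param_mem by simp

lemma C2_eta': "Ck_on (Suc (Suc 0)) (img_of c) (\<eta> \<circ> param c)"
  using C2_eta by (simp only: numeral_2_eq_2)

lemma C2_formD: "C2_form u \<Longrightarrow> Ck_on (Suc (Suc 0)) (img_of c) (u c \<circ> param c)"
  unfolding C2_form_def by (simp only: numeral_2_eq_2)

lemma C2_form_differentiable:
  "C2_form u \<Longrightarrow> y \<in> img_of c \<Longrightarrow> (u c \<circ> param c) differentiable (at y)"
  using Ck_on_Suc_differentiable[OF C2_formD] .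

lemma zero_form_loc: "(zero_form \<eta> :: ('a, 'n) form) c \<circ> param c =
    (\<lambda>y. axis ({}, {}) (complex_of_real ((\<eta> \<circ> param c) y)))"
  by (simp add: zero_form_def fun_eq_iff)

lemma eta_differentiable: "y \<in> img_of c \<Longrightarrow> (\<eta> \<circ> param c) differentiable (at y)"
  using Ck_on_Suc_differentiable[OF C2_eta'] .

lemma del_zero_form: "x \<in> dom_of c \<Longrightarrow>
    del (zero_form \<eta>) c x = symbol_grad del_symbol (\<eta> \<circ> param c) (coord c x)"
  unfolding del_eq zero_form_loc by (rule symbol_d_scalar[OF eta_differentiable]) simp

lemma delbar_zero_form: "x \<in> dom_of c \<Longrightarrow>
    delbar (zero_form \<eta>) c x = symbol_grad delbar_symbol (\<eta> \<circ> param c) (coord c x)"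
  unfolding delbar_eq zero_form_loc by (rule symbol_d_scalar[OF eta_differentiable]) simp

lemma del_delbar_zero_form:
  assumes "x \<in> dom_of c"
  shows "symbol_d del_symbol (symbol_grad delbar_symbol (\<eta> \<circ> param c)) (coord c x) =
    del (delbar (zero_form \<eta>)) c x"
  unfolding del_eq[of "delbar _"]
  by (rule symbol_d_cong[OF open_img]) (use assms in \<open>auto simp: delbar_zero_form param_mem\<close>)

lemma del_delbar_loc:
  assumes "x \<in> dom_of c"
  shows "symbol_d del_symbol (symbol_d delbar_symbol (u c \<circ> param c)) (coord c x) = del (delbar u) c x"
  unfolding del_eq[of "delbar u"]
  by (rule symbol_d_cong[OF open_img]) (use assms in \<open>auto simp: delbar_eq\<close>)

section \<open>Local expressions and bidegrees of the twisted operators\<close>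

lemma p_weight_bidegree: "bidegree_on p q u \<Longrightarrow> x \<in> dom_of c \<Longrightarrow> p_weight u c x = of_nat p *s u c x"
  by (auto simp: p_weight_def bidegree_on_def ext_bidegree_def vec_eq_iff)

lemma D01_eq:
  assumes "bidegree_on p q u" "x \<in> dom_of c"
  shows "D01 \<eta> u c x = symbol_d delbar_symbol (u c \<circ> param c) (coord c x) - complex_of_real (1 / \<eta> x) *s
    ext_wedge (symbol_grad delbar_symbol (\<eta> \<circ> param c) (coord c x)) (of_nat p *s u c x)"
  by (simp add: D01_def fmult_def wedge_def p_weight_bidegree[OF assms] delbar_zero_form[OF assms(2)]
      delbar_eq[of u])

text \<open>Conjugation exchanges p and q, so the weight becomes q. Differentiability is asked only
  at the point, because the formula is later applied to \<open>D01 \<eta> u\<close>, where one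
  derivative has already been spent.\<close>

lemma D01_conj_eq:
  assumes u: "bidegree_on p q u" and x: "x \<in> dom_of c"
    and diff: "(u c \<circ> param c) differentiable (at (coord c x))"
  shows "D01_conj \<eta> u c x = symbol_d del_symbol (u c \<circ> param c) (coord c x) - complex_of_real (1 / \<eta> x) *s
    ext_wedge (symbol_grad del_symbol (\<eta> \<circ> param c) (coord c x)) (of_nat q *s u c x)"
proof -
  have "bidegree_on q p (conj_form u)"
    using u by (simp add: bidegree_on_def conj_form_def ext_bidegree_cnj)
  moreover have "conj_form u c \<circ> param c = (\<lambda>y. ext_cnj ((u c \<circ> param c) y))"
    by (simp add: conj_form_def fun_eq_iff)
  ultimately show ?thesis
    using symbol_d_cnj[OF diff]
    by (simp add: D01_conj_def conj_form_def[of "D01 _ _"] D01_eq[OF _ x] ext_cnj_diff ext_cnj_smult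
        ext_cnj_wedge symbol_grad_cnj) (simp add: conj_form_def)
qed

lemma D01_loc:
  assumes "bidegree_on p q u" "y \<in> img_of c"
  shows "(D01 \<eta> u c \<circ> param c) y = symbol_d delbar_symbol (u c \<circ> param c) y
    - complex_of_real (1 / (\<eta> \<circ> param c) y) *s
      ext_wedge (symbol_grad delbar_symbol (\<eta> \<circ> param c) y) (of_nat p *s (u c \<circ> param c) y)"
  using D01_eq[OF assms(1) param_mem[OF assms(2)]] assms(2) by simp

lemma D01_conj_loc:
  assumes "bidegree_on p q u" "C2_form u" "y \<in> img_of c"
  shows "(D01_conj \<eta> u c \<circ> param c) y = symbol_d del_symbol (u c \<circ> param c) y
    - complex_of_real (1 / (\<eta> \<circ> param c) y) *s
      ext_wedge (symbol_grad del_symbol (\<eta> \<circ> param c) y) (of_nat q *s (u c \<circ> param c) y)"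
  using D01_conj_eq[OF assms(1) param_mem[OF assms(3)]] C2_form_differentiable[OF assms(2,3)] assms(3)
  by simp

text \<open>Together with its conjugate below, this determines the weight that the outer operator of
  a composition carries.\<close>

lemma bidegree_on_D01:
  assumes "bidegree_on p q u" "C2_form u"
  shows "bidegree_on p (Suc q) (D01 \<eta> u)"
  unfolding bidegree_on_def
proof
  fix x assume x: "x \<in> dom_of c"
  have "ext_bidegree (0 + p) (1 + q) (symbol_d delbar_symbol (u c \<circ> param c) (coord c x))"
    by (rule ext_bidegree_symbol_d[OF ext_bidegree_delbar_symbol open_img])
      (use assms x C2_form_differentiable in \<open>auto simp: bidegree_on_def param_mem\<close>)
  moreover have "ext_bidegree (0 + p) (1 + q)
      (ext_wedge (symbol_grad delbar_symbol (\<eta> \<circ> param c) (coord c x)) (of_nat p *s u c x))"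
    using assms(1) x unfolding bidegree_on_def symbol_grad_def
    by (intro ext_bidegree_wedge ext_bidegree_sum ext_bidegree_smult ext_bidegree_delbar_symbol) auto
  ultimately show "ext_bidegree p (Suc q) (D01 \<eta> u c x)"
    unfolding D01_eq[OF assms(1) x] by (auto intro!: ext_bidegree_diff ext_bidegree_smult)
qed

lemma bidegree_on_D01_conj:
  assumes "bidegree_on p q u" "C2_form u"
  shows "bidegree_on (Suc p) q (D01_conj \<eta> u)"
  unfolding bidegree_on_def
proof
  fix x assume x: "x \<in> dom_of c"
  have diff: "(u c \<circ> param c) differentiable (at (coord c x))"
    using C2_form_differentiable[OF assms(2)] x by simp
  have "ext_bidegree (1 + p) (0 + q) (symbol_d del_symbol (u c \<circ> param c) (coord c x))"
    by (rule ext_bidegree_symbol_d[OF ext_bidegree_del_symbol open_img])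
      (use assms x C2_form_differentiable in \<open>auto simp: bidegree_on_def param_mem\<close>)
  moreover have "ext_bidegree (1 + p) (0 + q)
      (ext_wedge (symbol_grad del_symbol (\<eta> \<circ> param c) (coord c x)) (of_nat q *s u c x))"
    using assms(1) x unfolding bidegree_on_def symbol_grad_def
    by (intro ext_bidegree_wedge ext_bidegree_sum ext_bidegree_smult ext_bidegree_del_symbol) auto
  ultimately show "ext_bidegree (Suc p) q (D01_conj \<eta> u c x)"
    unfolding D01_conj_eq[OF assms(1) x diff] by (auto intro!: ext_bidegree_diff ext_bidegree_smult)
qed

lemma D01_differentiable:
  assumes "bidegree_on p q u" "C2_form u" "y \<in> img_of c"
  shows "(D01 \<eta> u c \<circ> param c) differentiable (at y)"
proof (rule differentiable_cong_open[OF open_img assms(3)])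
  show "(\<lambda>y. symbol_d delbar_symbol (u c \<circ> param c) y
    - complex_of_real (1 / (\<eta> \<circ> param c) y) *s
      ext_wedge (symbol_grad delbar_symbol (\<eta> \<circ> param c) y) (of_nat p *s (u c \<circ> param c) y))
    differentiable (at y)"
    using Ck_on_Suc_differentiable[OF Ck_on_twist[OF open_img C2_formD[OF assms(2)] C2_eta' eta_param_nz] assms(3)] .
qed (simp only: D01_loc[OF assms(1)])

text \<open>The inner operator produces bidegree (p + 1, q), so the outer twist has weight p + 1,
  the coefficient of \<open>b \<and> del u\<close>. In the last term, one q comes from
  differentiating \<open>1 / \<eta>\<close> and q (p + 1) from the product of the two twists, in
  total q (p + 2); its minus sign is due to reordering \<open>b \<and> a\<close> into
  \<open>a \<and> b\<close>.\<close>

lemma D01_D01_conj: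
  fixes u :: "('a, 'n) form"
  assumes "bidegree_on p q u" "C2_form u" and x: "x \<in> dom_of c"
  defines "r \<equiv> complex_of_real (1 / \<eta> x)"
    and "a \<equiv> del (zero_form \<eta>) c x" and "b \<equiv> delbar (zero_form \<eta>) c x"
  shows "D01 \<eta> (D01_conj \<eta> u) c x = - del (delbar u) c x
    + (r * of_nat q) *s (ext_wedge (del (delbar (zero_form \<eta>)) c x) (u c x) + ext_wedge a (delbar u c x))
    - (r * (of_nat p + 1)) *s ext_wedge b (del u c x)
    - (r\<^sup>2 * of_nat q * (of_nat p + 2)) *s ext_wedge a (ext_wedge b (u c x))"
proof -
  let ?z = "coord c x" and ?U = "u c \<circ> param c" and ?e = "\<eta> \<circ> param c"
  have z: "?z \<in> img_of c" using x by simp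
  have ab: "ext_wedge b (ext_wedge a (u c x)) = - ext_wedge a (ext_wedge b (u c x))"
    unfolding a_def b_def del_zero_form[OF x] delbar_zero_form[OF x]
    by (intro one_form_anticommute ext_degree_symbol_grad one_form_symbol_del)
  have "symbol_d delbar_symbol (D01_conj \<eta> u c \<circ> param c) ?z =
      symbol_d delbar_symbol (\<lambda>y. symbol_d del_symbol ?U y
        - complex_of_real (1 / ?e y) *s ext_wedge (symbol_grad del_symbol ?e y) (of_nat q *s ?U y)) ?z"
    by (rule symbol_d_cong[OF open_img z D01_conj_loc[OF assms(1,2)]])
  also have "\<dots> = - del (delbar u) c x + (r\<^sup>2 * of_nat q) *s ext_wedge b (ext_wedge a (u c x))
      - (r * of_nat q) *s (- ext_wedge (del (delbar (zero_form \<eta>)) c x) (u c x) - ext_wedge a (delbar u c x))"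
    using symbol_d_twist[where e = ?e and q = "of_nat q", OF one_form_symbol_del(2,1) open_img z
        assms(2)[unfolded C2_form_def] C2_eta eta_param_nz[OF z]]
      symbol_d_anticommute[OF one_form_symbol_del(2,1) open_img z assms(2)[unfolded C2_form_def]]
      symbol_d_grad_anticommute[OF one_form_symbol_del(2,1) open_img z C2_eta] x
    by (simp add: del_delbar_zero_form del_delbar_loc r_def a_def b_def del_zero_form delbar_zero_form
        delbar_eq[of u] ext_wedge_minus_left power_divide)
  finally have 1: "symbol_d delbar_symbol (D01_conj \<eta> u c \<circ> param c) ?z = \<dots>" .
  show ?thesis
    unfolding D01_eq[OF bidegree_on_D01_conj[OF assms(1,2)] x] 1
      D01_conj_eq[OF assms(1) x C2_form_differentiable[OF assms(2) z]]
      r_def[symmetric] a_def[unfolded del_zero_form[OF x], symmetric]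
      b_def[unfolded delbar_zero_form[OF x], symmetric] del_eq[of u, symmetric]
    by (simp add: ext_wedge_smult_right ext_wedge_diff_right ab)
      (simp add: vec_eq_iff ext_wedge_add_right ext_wedge_smult_right algebra_simps power2_eq_square)
qed

text \<open>As above with the weight q + 1 of bidegree (p, q + 1): p and p (q + 1) add up to p (q +
  2). Here the one-forms already stand in the order \<open>a \<and> b\<close>, so this coefficient
  has the opposite sign.\<close>

lemma D01_conj_D01:
  fixes u :: "('a, 'n) form"
  assumes "bidegree_on p q u" "C2_form u" and x: "x \<in> dom_of c"
  defines "r \<equiv> complex_of_real (1 / \<eta> x)"
    and "a \<equiv> del (zero_form \<eta>) c x" and "b \<equiv> delbar (zero_form \<eta>) c x"
  shows "D01_conj \<eta> (D01 \<eta> u) c x = del (delbar u) c x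
    - (r * of_nat p) *s (ext_wedge (del (delbar (zero_form \<eta>)) c x) (u c x) - ext_wedge b (del u c x))
    - (r * (of_nat q + 1)) *s ext_wedge a (delbar u c x)
    + (r\<^sup>2 * of_nat p * (of_nat q + 2)) *s ext_wedge a (ext_wedge b (u c x))"
proof -
  let ?z = "coord c x" and ?U = "u c \<circ> param c" and ?e = "\<eta> \<circ> param c"
  have z: "?z \<in> img_of c" using x by simp
  have "symbol_d del_symbol (D01 \<eta> u c \<circ> param c) ?z =
      symbol_d del_symbol (\<lambda>y. symbol_d delbar_symbol ?U y
        - complex_of_real (1 / ?e y) *s ext_wedge (symbol_grad delbar_symbol ?e y) (of_nat p *s ?U y)) ?z"
    by (rule symbol_d_cong[OF open_img z D01_loc[OF assms(1)]])
  also have "\<dots> = del (delbar u) c x + (r\<^sup>2 * of_nat p) *s ext_wedge a (ext_wedge b (u c x))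
      - (r * of_nat p) *s (ext_wedge (del (delbar (zero_form \<eta>)) c x) (u c x) - ext_wedge b (del u c x))"
    using symbol_d_twist[where e = ?e and q = "of_nat p", OF one_form_symbol_del(1,2) open_img z
        assms(2)[unfolded C2_form_def] C2_eta eta_param_nz[OF z]] x
    by (simp add: del_delbar_zero_form del_delbar_loc r_def a_def b_def del_zero_form delbar_zero_form
        del_eq[of u] power_divide)
  finally have 1: "symbol_d del_symbol (D01 \<eta> u c \<circ> param c) ?z = \<dots>" .
  show ?thesis
    unfolding D01_conj_eq[OF bidegree_on_D01[OF assms(1,2)] x D01_differentiable[OF assms(1,2) z]] 1
      D01_eq[OF assms(1) x]
      r_def[symmetric] a_def[unfolded del_zero_form[OF x], symmetric]
      b_def[unfolded delbar_zero_form[OF x], symmetric] delbar_eq[of u, symmetric]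
    by (simp add: ext_wedge_smult_right ext_wedge_diff_right)
      (simp add: vec_eq_iff ext_wedge_add_right ext_wedge_smult_right algebra_simps power2_eq_square)
qed

text \<open>The second-order terms cancel. What remains is p (q + 2) - q (p + 2) = 2 (p - q) for
  \<open>a \<and> b \<and> u\<close>, q - p for the second derivative of \<open>\<eta>\<close>, and
  p - (p + 1) = q - (q + 1) = -1 for the two first-order terms.\<close>

lemma D01_commutator:
  fixes u :: "('a, 'n) form"
  assumes "bidegree_on p q u" "C2_form u" and x: "x \<in> dom_of c"
  defines "r \<equiv> complex_of_real (1 / \<eta> x)"
    and "a \<equiv> del (zero_form \<eta>) c x" and "b \<equiv> delbar (zero_form \<eta>) c x"
  shows "gcomm 1 1 (D01 \<eta>) (D01_conj \<eta>) u c x =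
    (r * (of_nat p - of_nat q)) *s (2 * r *s ext_wedge a (ext_wedge b (u c x))
      - ext_wedge (del (delbar (zero_form \<eta>)) c x) (u c x))
    - r *s (ext_wedge b (del u c x) + ext_wedge a (delbar u c x))"
proof -
  have "gcomm 1 1 (D01 \<eta>) (D01_conj \<eta>) u c x =
      D01 \<eta> (D01_conj \<eta> u) c x + D01_conj \<eta> (D01 \<eta> u) c x"
    by (simp add: gcomm_def cmult_def)
  then show ?thesis
    unfolding D01_D01_conj[OF assms(1-3)] D01_conj_D01[OF assms(1-3)] r_def[symmetric]
      a_def[symmetric] b_def[symmetric]
    by (simp add: vec_eq_iff algebra_simps power2_eq_square)
qed

text \<open>The twists are conjugations by powers of \<open>\<eta>\<close>. As
  \<open>\<omega>\<close> has q = 1, the inner \<open>del\<close> gives \<open>1 / \<eta>\<close>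
  times \<open>D01_conj \<eta> \<omega>\<close>, so the outer \<open>delbar\<close> acts on that
  form divided by the square of \<open>\<eta>\<close>. The form has bidegree (2, 1), and
  differentiating the inverse square yields the factor \<open>- 2 / \<eta>\<close>, exactly the
  twist of weight p = 2.\<close>

lemma del_delbar_quotient:
  fixes \<omega> :: "('a, 'n) form"
  assumes "bidegree_on 1 1 \<omega>" "C2_form \<omega>" and x: "x \<in> dom_of c"
  shows "complex_of_real ((\<eta> x)\<^sup>2) *s
      delbar ((\<lambda>x. 1 / \<eta> x) \<odot> del ((\<lambda>x. 1 / \<eta> x) \<odot> \<omega>)) c x = D01 \<eta> (D01_conj \<eta> \<omega>) c x"
proof -
  let ?z = "coord c x" and ?W = "\<omega> c \<circ> param c" and ?e = "\<eta> \<circ> param c"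
  let ?T = "\<lambda>y. symbol_d del_symbol ?W y
    - complex_of_real (1 / ?e y) *s ext_wedge (symbol_grad del_symbol ?e y) (of_nat 1 *s ?W y)"
  have z: "?z \<in> img_of c" using x by simp
  have inv: "((\<lambda>x. 1 / x) has_real_derivative - (1 / s\<^sup>2)) (at s)"
    "((\<lambda>x. (1 / x)\<^sup>2) has_real_derivative - (2 / s ^ 3)) (at s)" if "s \<noteq> 0" for s :: real
    using that by (auto intro!: derivative_eq_intros simp: field_simps power2_eq_square power3_eq_cube)
  have diff_inv: "(\<lambda>y. 1 / ?e y) differentiable (at y)" if "y \<in> img_of c" for y
    using differentiable_divide[OF differentiable_const eta_differentiable[OF that] eta_param_nz[OF that]] .
  have loc: "((\<lambda>x. 1 / \<eta> x) \<odot> del ((\<lambda>x. 1 / \<eta> x) \<odot> \<omega>)) c (param c y) =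
      complex_of_real ((1 / ?e y)\<^sup>2) *s ?T y" if y: "y \<in> img_of c" for y
  proof -
    have "((\<lambda>x. 1 / \<eta> x) \<odot> \<omega>) c \<circ> param c = (\<lambda>y. complex_of_real (1 / ?e y) *s ?W y)"
      by (simp add: fmult_def fun_eq_iff)
    then have "del ((\<lambda>x. 1 / \<eta> x) \<odot> \<omega>) c (param c y) =
        symbol_d del_symbol (\<lambda>y. complex_of_real (1 / ?e y) *s ?W y) y"
      by (simp only: del_eq coord_param[OF y])
    also have "\<dots> = complex_of_real (1 / ?e y) *s ?T y"
      unfolding symbol_d_fmult[OF diff_inv[OF y] C2_form_differentiable[OF assms(2) y]]
        symbol_grad_compose[OF eta_differentiable[OF y] inv(1)[OF eta_param_nz[OF y]]]
      by (simp add: ext_wedge_smult_left ext_wedge_minus_left vec_eq_iff algebra_simps power2_eq_square)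
    finally show ?thesis
      by (simp add: fmult_def power2_eq_square)
  qed
  have T: "?T differentiable (at ?z)"
    using Ck_on_Suc_differentiable[OF Ck_on_twist[OF open_img C2_formD[OF assms(2)] C2_eta' eta_param_nz] z] .
  have sq: "(\<lambda>y. (1 / ?e y)\<^sup>2) differentiable (at ?z)"
    unfolding power2_eq_square by (intro differentiable_mult diff_inv z)
  have "delbar ((\<lambda>x. 1 / \<eta> x) \<odot> del ((\<lambda>x. 1 / \<eta> x) \<odot> \<omega>)) c x =
      symbol_d delbar_symbol (\<lambda>y. complex_of_real ((1 / ?e y)\<^sup>2) *s ?T y) ?z"
    unfolding delbar_eq by (rule symbol_d_cong[OF open_img z]) (simp only: o_apply[of "_ c"] loc)
  also have "\<dots> = complex_of_real (- (2 / \<eta> x ^ 3)) *s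
        ext_wedge (symbol_grad delbar_symbol ?e ?z) (?T ?z)
      + complex_of_real ((1 / \<eta> x)\<^sup>2) *s symbol_d delbar_symbol ?T ?z"
    unfolding symbol_d_fmult[OF sq T]
      symbol_grad_compose[OF eta_differentiable[OF z] inv(2)[OF eta_param_nz[OF z]]]
    using x by (simp only: ext_wedge_smult_left o_apply[of \<eta>] param_coord)
  also have "symbol_d delbar_symbol ?T ?z = symbol_d delbar_symbol (D01_conj \<eta> \<omega> c \<circ> param c) ?z"
    by (rule symbol_d_cong[OF open_img z]) (simp only: D01_conj_loc[OF assms(1,2)])
  also have "?T ?z = D01_conj \<eta> \<omega> c x"
    using D01_conj_loc[OF assms(1,2) z] x by (simp only: o_apply[of "_ c"] param_coord)
  finally have "complex_of_real ((\<eta> x)\<^sup>2) *s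
      delbar ((\<lambda>x. 1 / \<eta> x) \<odot> del ((\<lambda>x. 1 / \<eta> x) \<odot> \<omega>)) c x =
      complex_of_real ((\<eta> x)\<^sup>2 * - (2 / \<eta> x ^ 3)) *s
        ext_wedge (symbol_grad delbar_symbol ?e ?z) (D01_conj \<eta> \<omega> c x)
      + complex_of_real ((\<eta> x)\<^sup>2 * (1 / \<eta> x)\<^sup>2) *s
        symbol_d delbar_symbol (D01_conj \<eta> \<omega> c \<circ> param c) ?z"
    by (simp only: vec.scale_right_distrib vec.scale_scale of_real_mult)
  also have "(\<eta> x)\<^sup>2 * - (2 / \<eta> x ^ 3) = - (2 * (1 / \<eta> x))"
    using eta_nz[OF x] by (simp add: power2_eq_square power3_eq_cube)
  also have "(\<eta> x)\<^sup>2 * (1 / \<eta> x)\<^sup>2 = 1"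
    using eta_nz[OF x] by (simp add: power_divide)
  finally have *: "complex_of_real ((\<eta> x)\<^sup>2) *s
      delbar ((\<lambda>x. 1 / \<eta> x) \<odot> del ((\<lambda>x. 1 / \<eta> x) \<odot> \<omega>)) c x =
      complex_of_real (- (2 * (1 / \<eta> x))) *s
        ext_wedge (symbol_grad delbar_symbol ?e ?z) (D01_conj \<eta> \<omega> c x)
      + complex_of_real 1 *s symbol_d delbar_symbol (D01_conj \<eta> \<omega> c \<circ> param c) ?z" .
  show ?thesis
    unfolding * D01_eq[OF bidegree_on_D01_conj[OF assms(1,2)] x]
    by (simp add: ext_wedge_smult_right vec_eq_iff)
qed

end

lemma dolbeault_chart_hermitian:
  fixes A :: "('a, 'n::{finite,linorder}) chart set"
  assumes "hermitian_manifold X A \<omega>" "smooth_function A \<eta>"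
    "(\<forall>x\<in>topspace X. \<eta> x > 0) \<or> (\<forall>x\<in>topspace X. \<eta> x < 0)" "c \<in> A"
  shows "dolbeault_chart c \<eta>"
proof
  have c: "is_chart X c"
    using assms(1,4) by (simp add: hermitian_manifold_def complex_manifold_def)
  then have sub: "dom_of c \<subseteq> topspace X"
    by (simp add: is_chart_def openin_subset)
  then show "inj_on (coord c) (dom_of c)"
    using c homeomorphic_imp_injective_map[of "subtopology X (dom_of c)"]
    by (auto simp: is_chart_def Int_absorb1)
  show "open (img_of c)" using c by (simp add: is_chart_def)
  show "Ck_on 2 (img_of c) (\<eta> \<circ> param c)"
    using assms(2,4) by (simp add: smooth_function_def smooth_on_def)
  show "\<eta> x \<noteq> 0" if "x \<in> dom_of c" for x
    using assms(3) sub that by force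
qed

theorem proposition4p7:
  fixes X :: "'a topology"
    and A :: "('a, 'n::{finite,linorder}) chart set"
    and \<omega> :: "('a, 'n) form"
    and \<eta> :: "'a \<Rightarrow> real"
  assumes "hermitian_manifold X A \<omega>"
    and "CARD('n) \<ge> 2"
    and "smooth_function A \<eta>"
    and "(\<forall>x\<in>topspace X. \<eta> x > 0) \<or> (\<forall>x\<in>topspace X. \<eta> x < 0)"
  defines "\<Lambda> \<equiv> Lambda \<omega>"
    and "D \<equiv> (D01 \<eta> :: ('a, 'n) form \<Rightarrow> ('a, 'n) form)"
    and "D' \<equiv> (D01_conj \<eta> :: ('a, 'n) form \<Rightarrow> ('a, 'n) form)"
    and "d\<eta> \<equiv> (del (zero_form \<eta>) :: ('a, 'n) form)"
    and "db\<eta> \<equiv> (delbar (zero_form \<eta>) :: ('a, 'n) form)"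
    and "ddb\<eta> \<equiv> (del (delbar (zero_form \<eta>)) :: ('a, 'n) form)"
  shows
    "(\<forall>p q u. smooth_form A u \<and> has_bidegree A p q u \<longrightarrow>
      same_form A
        (\<i> \<cdot> gcomm 1 1 D D' u)
        (- ((\<lambda>x. 1 / \<eta> x) \<odot> ((\<i> \<cdot> db\<eta>) \<^bold>\<and> del u + (\<i> \<cdot> d\<eta>) \<^bold>\<and> delbar u))
          + (\<lambda>x. (real p - real q) / \<eta> x) \<odot>
              (((\<lambda>x. 2 / \<eta> x) \<odot> ((\<i> \<cdot> d\<eta>) \<^bold>\<and> db\<eta>) - \<i> \<cdot> ddb\<eta>) \<^bold>\<and> u)) \<and>
      same_form A
        (\<i> \<cdot> gcomm 2 (-2) (gcomm 1 1 D D') \<Lambda> u)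
        ((\<lambda>x. 1 / \<eta> x) \<odot> gcomm (-2) 1 \<Lambda> (\<lambda>v. (\<i> \<cdot> db\<eta>) \<^bold>\<and> v) (del u)
          + (\<lambda>x. 1 / \<eta> x) \<odot> gcomm (-2) 1 \<Lambda> (\<lambda>v. (\<i> \<cdot> d\<eta>) \<^bold>\<and> v) (delbar u)
          + (\<lambda>x. 1 / \<eta> x) \<odot> ((\<i> \<cdot> db\<eta>) \<^bold>\<and> gcomm (-2) 1 \<Lambda> del u)
          + (\<lambda>x. 1 / \<eta> x) \<odot> ((\<i> \<cdot> d\<eta>) \<^bold>\<and> gcomm (-2) 1 \<Lambda> delbar u)
          + (\<lambda>x. real p - real q) \<odot>
              gcomm 2 (-2)
                (\<lambda>v. ((\<lambda>x. 2 / (\<eta> x)\<^sup>2) \<odot> ((\<i> \<cdot> d\<eta>) \<^bold>\<and> db\<eta>)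
                       - (\<lambda>x. 1 / \<eta> x) \<odot> (\<i> \<cdot> ddb\<eta>)) \<^bold>\<and> v)
                \<Lambda> u)) \<and>
      same_form A
        (D (D' \<omega>))
        ((\<lambda>x. (\<eta> x)\<^sup>2) \<odot> delbar ((\<lambda>x. 1 / \<eta> x) \<odot> del ((\<lambda>x. 1 / \<eta> x) \<odot> \<omega>))) \<and>
      same_form A
        ((\<lambda>x. (\<eta> x)\<^sup>2) \<odot> delbar ((\<lambda>x. 1 / \<eta> x) \<odot> del ((\<lambda>x. 1 / \<eta> x) \<odot> \<omega>)))
        (- del (delbar \<omega>)
          - (\<lambda>x. 1 / \<eta> x) \<odot> (2 \<cdot> (db\<eta> \<^bold>\<and> del \<omega>) - d\<eta> \<^bold>\<and> delbar \<omega>)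
          + (\<lambda>x. 1 / \<eta> x) \<odot>
              ((ddb\<eta> - (\<lambda>x. 3 / \<eta> x) \<odot> (d\<eta> \<^bold>\<and> db\<eta>)) \<^bold>\<and> \<omega>))"
proof -
  let ?L = "\<lambda>c x. ext_Lambda (\<omega> c x)"
  have chart: "dolbeault_chart c \<eta>" if "c \<in> A" for c
    using dolbeault_chart_hermitian[OF assms(1,3,4) that] .
  have pos: "pos_def_11 (\<omega> c x)" if "c \<in> A" "x \<in> dom_of c" for c x
    using assms(1) that by (simp add: hermitian_manifold_def)
  have C2: "dolbeault_chart.C2_form c u" if "smooth_form A u" "c \<in> A" for c and u :: "('a, 'n) form"
    using that by (simp add: dolbeault_chart.C2_form_def[OF chart] smooth_form_def smooth_on_def)
  have bideg: "dolbeault_chart.bidegree_on c p q u" if "has_bidegree A p q u" "c \<in> A"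
    for c p q and u :: "('a, 'n) form"
    using that by (auto simp: dolbeault_chart.bidegree_on_def[OF chart] has_bidegree_def ext_bidegree_def)
  have comm: "\<i> *s gcomm 1 1 D D' u c x =
      (- ((\<lambda>x. 1 / \<eta> x) \<odot> ((\<i> \<cdot> db\<eta>) \<^bold>\<and> del u + (\<i> \<cdot> d\<eta>) \<^bold>\<and> delbar u))
          + (\<lambda>x. (real p - real q) / \<eta> x) \<odot>
              (((\<lambda>x. 2 / \<eta> x) \<odot> ((\<i> \<cdot> d\<eta>) \<^bold>\<and> db\<eta>) - \<i> \<cdot> ddb\<eta>) \<^bold>\<and> u)) c x"
    if u: "dolbeault_chart.bidegree_on c p q u" "dolbeault_chart.C2_form c u" and c: "c \<in> A"
      and x: "x \<in> dom_of c" for p q u c x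
  proof -
    \<comment> \<open>All reciprocals are expressed through the single atom
      \<open>1 / \<eta> x\<close>, which the final normalisation keeps intact by
      \<open>del: of_real_divide\<close>.\<close>
    have r: "complex_of_real ((real p - real q) / \<eta> x) = (of_nat p - of_nat q) * complex_of_real (1 / \<eta> x)"
      "complex_of_real (2 / \<eta> x) = 2 * complex_of_real (1 / \<eta> x)"
      by simp_all
    show ?thesis
      unfolding D_def D'_def dolbeault_chart.D01_commutator[OF chart[OF c] u x] db\<eta>_def d\<eta>_def ddb\<eta>_def
        cmult_def fmult_def wedge_def plus_fun_apply minus_apply uminus_apply r
      by (simp only: ext_wedge_smult_left ext_wedge_smult_right ext_wedge_diff_left ext_wedge_assoc)
        (simp only: vec_eq_iff vector_add_component vector_minus_component vector_uminus_component
          vector_smult_component, simp add: algebra_simps del: of_real_divide)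
  qed
  have commutator: "same_form A (\<i> \<cdot> gcomm 1 1 D D' u)
        (- ((\<lambda>x. 1 / \<eta> x) \<odot> ((\<i> \<cdot> db\<eta>) \<^bold>\<and> del u + (\<i> \<cdot> d\<eta>) \<^bold>\<and> delbar u))
          + (\<lambda>x. (real p - real q) / \<eta> x) \<odot>
              (((\<lambda>x. 2 / \<eta> x) \<odot> ((\<i> \<cdot> d\<eta>) \<^bold>\<and> db\<eta>) - \<i> \<cdot> ddb\<eta>) \<^bold>\<and> u))"
    if "smooth_form A u" "has_bidegree A p q u" for p q u
    using comm[OF bideg C2] that by (simp add: same_form_def cmult_def)
  have Lambda_commutator: "same_form A
        (\<i> \<cdot> gcomm 2 (-2) (gcomm 1 1 D D') \<Lambda> u)
        ((\<lambda>x. 1 / \<eta> x) \<odot> gcomm (-2) 1 \<Lambda> (\<lambda>v. (\<i> \<cdot> db\<eta>) \<^bold>\<and> v) (del u)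
          + (\<lambda>x. 1 / \<eta> x) \<odot> gcomm (-2) 1 \<Lambda> (\<lambda>v. (\<i> \<cdot> d\<eta>) \<^bold>\<and> v) (delbar u)
          + (\<lambda>x. 1 / \<eta> x) \<odot> ((\<i> \<cdot> db\<eta>) \<^bold>\<and> gcomm (-2) 1 \<Lambda> del u)
          + (\<lambda>x. 1 / \<eta> x) \<odot> ((\<i> \<cdot> d\<eta>) \<^bold>\<and> gcomm (-2) 1 \<Lambda> delbar u)
          + (\<lambda>x. real p - real q) \<odot>
              gcomm 2 (-2)
                (\<lambda>v. ((\<lambda>x. 2 / (\<eta> x)\<^sup>2) \<odot> ((\<i> \<cdot> d\<eta>) \<^bold>\<and> db\<eta>)
                       - (\<lambda>x. 1 / \<eta> x) \<odot> (\<i> \<cdot> ddb\<eta>)) \<^bold>\<and> v)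
                \<Lambda> u)"
    if u: "smooth_form A u" "has_bidegree A p q u" for p q u
    unfolding same_form_def
  proof (intro ballI)
    fix c x assume c: "c \<in> A" and x: "x \<in> dom_of c"
    interpret dolbeault_chart c \<eta> by (rule chart[OF c])
    have L_add: "?L c x (v + w) = ?L c x v + ?L c x w" and L_smult: "?L c x (s *s v) = s *s ?L c x v" for v w s
      unfolding ext_Lambda_eq[OF pos[OF c x]] by (rule contraction_Lambda_add contraction_Lambda_smult)+
    have L_diff: "?L c x (v - w) = ?L c x v - ?L c x w" for v w
      using L_add[of "v - w" w] by simp
    \<comment> \<open>If p or q is 0, then \<open>\<Lambda> u\<close> vanishes on the chart and has
      every bidegree, so (p, q) itself can be reused; this keeps the difference p - q where
      truncated subtraction would spoil it.\<close>
    obtain p' q' where p'q': "bidegree_on p' q' (\<Lambda> u)"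
      and pq: "complex_of_nat p' - of_nat q' = of_nat p - of_nat q"
    proof (cases "p = 0 \<or> q = 0")
      case True
      then have "bidegree_on p q (\<Lambda> u)"
        using bideg[OF u(2) c] ext_Lambda_bidegree[OF pos[OF c]]
        by (fastforce simp: bidegree_on_def \<Lambda>_def Lambda_def ext_bidegree_zero)
      then show ?thesis using that by blast
    next
      case False
      have "bidegree_on (p - 1) (q - 1) (\<Lambda> u)"
        unfolding bidegree_on_def \<Lambda>_def Lambda_def
      proof
        fix y assume y: "y \<in> dom_of c"
        then show "ext_bidegree (p - 1) (q - 1) (?L c y (u c y))"
          using ext_Lambda_bidegree[OF pos[OF c y], of p q "u c y"] bideg[OF u(2) c] False
          by (simp add: bidegree_on_def)
      qed
      moreover have "complex_of_nat (p - 1) - of_nat (q - 1) = of_nat p - of_nat q"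
        using False by (simp add: of_nat_diff)
      ultimately show ?thesis using that by blast
    qed
    \<comment> \<open>The commutator formula is about to be applied to \<open>\<Lambda> u\<close>,
      which takes two derivatives of it.\<close>
    have C2_\<Lambda>: "C2_form (\<Lambda> u)"
    proof -
      have "Ck_on 2 (img_of c) (\<omega> c \<circ> param c)" "Ck_on 2 (img_of c) (u c \<circ> param c)"
        using assms(1) u(1) c by (auto simp: hermitian_manifold_def smooth_form_def smooth_on_def)
      from Ck_on_ext_Lambda[OF open_img this(1) _ this(2)] show ?thesis
        using pos[OF c] param_mem by (simp add: C2_form_def \<Lambda>_def Lambda_def o_def)
    qed
    note Cu = D01_commutator[OF bideg[OF u(2) c] C2[OF u(1) c] x, folded D_def D'_def]
    note C\<Lambda>u = D01_commutator[OF p'q' C2_\<Lambda> x, folded D_def D'_def, unfolded pq]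
    have r: "complex_of_real (2 / (\<eta> x)\<^sup>2) = 2 * complex_of_real (1 / \<eta> x) * complex_of_real (1 / \<eta> x)"
      by (simp add: power2_eq_square)
    \<comment> \<open>\<open>\<Lambda>\<close> has even degree, so every graded commutator with it
      is an ordinary one.\<close>
    have even: "gcomm 2 (-2) P \<Lambda> v = P (\<Lambda> v) - \<Lambda> (P v)" "gcomm (-2) 1 \<Lambda> P v = \<Lambda> (P v) - P (\<Lambda> v)"
      for P :: "('a, 'n) form \<Rightarrow> ('a, 'n) form" and v
      by (simp_all add: gcomm_def cmult_def fun_eq_iff)
    have \<Lambda>: "\<Lambda> v c x = ?L c x (v c x)" for v by (simp add: \<Lambda>_def Lambda_def)
    \<comment> \<open>Each first-order difference such as
      \<open>\<Lambda> (b \<and> del u) - b \<and> del (\<Lambda> u)\<close> splits into two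
      brackets by inserting \<open>b \<and> \<Lambda> (del u)\<close> with both signs; read
      backwards, these terms cancel on the right side.\<close>
    show "(\<i> \<cdot> gcomm 2 (-2) (gcomm 1 1 D D') \<Lambda> u) c x =
        ((\<lambda>x. 1 / \<eta> x) \<odot> gcomm (-2) 1 \<Lambda> (\<lambda>v. (\<i> \<cdot> db\<eta>) \<^bold>\<and> v) (del u)
          + (\<lambda>x. 1 / \<eta> x) \<odot> gcomm (-2) 1 \<Lambda> (\<lambda>v. (\<i> \<cdot> d\<eta>) \<^bold>\<and> v) (delbar u)
          + (\<lambda>x. 1 / \<eta> x) \<odot> ((\<i> \<cdot> db\<eta>) \<^bold>\<and> gcomm (-2) 1 \<Lambda> del u)
          + (\<lambda>x. 1 / \<eta> x) \<odot> ((\<i> \<cdot> d\<eta>) \<^bold>\<and> gcomm (-2) 1 \<Lambda> delbar u)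
          + (\<lambda>x. real p - real q) \<odot>
              gcomm 2 (-2)
                (\<lambda>v. ((\<lambda>x. 2 / (\<eta> x)\<^sup>2) \<odot> ((\<i> \<cdot> d\<eta>) \<^bold>\<and> db\<eta>)
                       - (\<lambda>x. 1 / \<eta> x) \<odot> (\<i> \<cdot> ddb\<eta>)) \<^bold>\<and> v)
                \<Lambda> u) c x"
      unfolding even db\<eta>_def d\<eta>_def ddb\<eta>_def
        cmult_def fmult_def wedge_def plus_fun_apply minus_apply uminus_apply \<Lambda> Cu C\<Lambda>u r of_real_diff of_real_of_nat_eq
      by (simp only: ext_wedge_smult_left ext_wedge_smult_right ext_wedge_diff_left ext_wedge_diff_right
          ext_wedge_assoc L_add L_diff L_smult)
        (simp only: vec_eq_iff vector_add_component vector_minus_component vector_uminus_component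
          vector_smult_component, simp add: algebra_simps del: of_real_divide)
  qed
  have \<omega>: "smooth_form A \<omega>" "has_bidegree A 1 1 \<omega>"
    using assms(1) by (auto simp: hermitian_manifold_def has_bidegree_def pos_def_11_def)
  have DD': "same_form A (D (D' \<omega>))
      ((\<lambda>x. (\<eta> x)\<^sup>2) \<odot> delbar ((\<lambda>x. 1 / \<eta> x) \<odot> del ((\<lambda>x. 1 / \<eta> x) \<odot> \<omega>)))"
    using dolbeault_chart.del_delbar_quotient[OF chart bideg[OF \<omega>(2)] C2[OF \<omega>(1)]]
    by (simp add: same_form_def D_def D'_def fmult_def[of "\<lambda>x. (\<eta> x)\<^sup>2"])
  \<comment> \<open>The composition formula at p = q = 1: the constants 2 and 3 are p + 1 and q (p +
    2).\<close>
  have "same_form A (D (D' \<omega>))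
        (- del (delbar \<omega>)
          - (\<lambda>x. 1 / \<eta> x) \<odot> (2 \<cdot> (db\<eta> \<^bold>\<and> del \<omega>) - d\<eta> \<^bold>\<and> delbar \<omega>)
          + (\<lambda>x. 1 / \<eta> x) \<odot>
              ((ddb\<eta> - (\<lambda>x. 3 / \<eta> x) \<odot> (d\<eta> \<^bold>\<and> db\<eta>)) \<^bold>\<and> \<omega>))"
    unfolding same_form_def
  proof (intro ballI)
    fix c x assume c: "c \<in> A" and x: "x \<in> dom_of c"
    have r: "complex_of_real (3 / \<eta> x) = 3 * complex_of_real (1 / \<eta> x)" by simp
    show "D (D' \<omega>) c x = (- del (delbar \<omega>)
          - (\<lambda>x. 1 / \<eta> x) \<odot> (2 \<cdot> (db\<eta> \<^bold>\<and> del \<omega>) - d\<eta> \<^bold>\<and> delbar \<omega>)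
          + (\<lambda>x. 1 / \<eta> x) \<odot>
              ((ddb\<eta> - (\<lambda>x. 3 / \<eta> x) \<odot> (d\<eta> \<^bold>\<and> db\<eta>)) \<^bold>\<and> \<omega>)) c x"
      unfolding D_def D'_def db\<eta>_def d\<eta>_def ddb\<eta>_def
        dolbeault_chart.D01_D01_conj[OF chart[OF c] bideg[OF \<omega>(2) c] C2[OF \<omega>(1) c] x]
        cmult_def fmult_def wedge_def plus_fun_apply minus_apply uminus_apply r
      by (simp only: ext_wedge_smult_left ext_wedge_smult_right ext_wedge_diff_left ext_wedge_assoc)
        (simp only: vec_eq_iff vector_add_component vector_minus_component vector_uminus_component
          vector_smult_component, simp add: algebra_simps power2_eq_square)
  qed
  with DD' have "same_form A
        ((\<lambda>x. (\<eta> x)\<^sup>2) \<odot> delbar ((\<lambda>x. 1 / \<eta> x) \<odot> del ((\<lambda>x. 1 / \<eta> x) \<odot> \<omega>)))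
        (- del (delbar \<omega>)
          - (\<lambda>x. 1 / \<eta> x) \<odot> (2 \<cdot> (db\<eta> \<^bold>\<and> del \<omega>) - d\<eta> \<^bold>\<and> delbar \<omega>)
          + (\<lambda>x. 1 / \<eta> x) \<odot>
              ((ddb\<eta> - (\<lambda>x. 3 / \<eta> x) \<odot> (d\<eta> \<^bold>\<and> db\<eta>)) \<^bold>\<and> \<omega>))"
    by (simp add: same_form_def)
  with commutator Lambda_commutator DD' show ?thesis by blast
qed

end
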